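(* Let $\mathscr{A}=(\mathscr{C},\mathscr{O})$ be an algebra inherited from the algebra $\mathfrak{G}$ of finite graphs, and let $\varphi$ be a sentence of the monadic second-order language of graphs. Then for every $n\in\mathbb{N}$, the set $\{\,G\in\mathscr{C}_n : \models_{\Omega(G)}\varphi\,\}$ is $\mathscr{A}$-recognisable.
   Context: Graphs. $\mathbb{N}$ contains $0$. A graph is $G=(V,E,\langle\_\rangle)$ with $V$ a finite nonempty set of vertices, $E$ a finite set of edges disjoint from $V$, and $\langle\_\rangle:E\to V^*$ assigning to every edge $e$ a nonempty finite word of vertices (its end points); $|e|$ denotes the length of $\langle e\rangle$. (So graphs are hypergraphs; parallel edges and repeated end points are allowed.) A graph of type $n\in\mathbb{N}$ is a graph together with a (not necessarily injective) map $t:\{1,\dots,n\}\to V$; the $t(i)$ are its terminals. $\mathfrak{G}_n$ is the set of graphs of type $n$; names of vertices and edges are immaterial, i.e. two typed graphs are identified if there are bijections of vertices and edges preserving the words $\langle e\rangle$ and the map $t$. Monadic second-order language of graphs. Formulas are built with $\neg,\wedge,\forall$ (other connectives and $\exists$ being abbreviations) from individual variables and set variables (unary predicate variables), with atomic formulas $\mathrm{vert}(x)$, $\mathrm{edge}(x)$, $x=y$, $X(x)$ and, for each $m\in\mathbb{N}$, $\mathrm{conn}_m(y,x_1,\dots,x_m)$; quantification is over individual variables and set variables. A sentence is a formula without free variables. In the structure $\Omega(G)$ induced by a graph $G$, individual variables range over $V\cup E$, set variables range over all subsets of $V$ and all subsets of $E$, $\mathrm{vert}$ and $\mathrm{edge}$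 mean membership in $V$ and $E$, $X(x)$ means $x\in X$, and $\mathrm{conn}_m(y,x_1,\dots,x_m)$ holds iff $y\in E$ and $\langle y\rangle=x_1\cdots x_m$. (Terminals are not visible.) $\models_{\Omega(G)}\varphi$ means $\varphi$ is true in $\Omega(G)$. Algebras. A signature $\mathscr{S}=(\mathscr{T},\mathscr{F},\langle\_\rangle)$ consists of a set $\mathscr T$ of sorts, a set $\mathscr F$ of function symbols and a typing $\langle f\rangle=(t_1\cdots t_r,t)\in\mathscr{T}^*\times\mathscr{T}$ for $f\in\mathscr{F}$ ($r$ is the arity, $t$ the output sort). An $\mathscr{S}$-algebra $\mathscr{A}=(\mathscr{C},\mathscr{O})$ consists of disjoint carrier sets $\mathscr{C}_t$ ($t\in\mathscr{T}$) and operations $\mathscr{O}_f:\mathscr{C}_{t_1}\times\dots\times\mathscr{C}_{t_r}\to\mathscr{C}_t$. An $\mathscr{S}$-algebra morphism is a sort-indexed family of maps of carriers commuting with all operations. An algebra is locally finite if each carrier is finite. For $t\in\mathscr T$, a subset $\mathscr{L}\subseteq\mathscr{C}_t$ is $\mathscr{A}$-recognisable if there are a locally finite $\mathscr{S}$-algebra $\mathscr{B}$ with carriers $\mathscr{D}_u$, an $\mathscr{S}$-algebra morphism $h=(h_u)_u:\mathscr{A}\to\mathscr{B}$ and a subset $\mathscr{M}\subseteq\mathscr{D}_t$ with $\mathscr{L}=h_t^{-1}(\mathscr{M})$. Inherited algebras. A pre-expression over a signature is a finite nonempty rooted ordered tree with vertices labelled by function symbols such that a vertex labelled $f$ has either no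 children or exactly as many children as the arity of $f$, in the latter case with the output sorts of the children's labels equal, in order, to the input sorts of $f$. Its input type is the concatenation, over the leaves in traversal order, of the input types of their labels; its output sort is that of the root label. In an algebra it defines, by evaluating from the leaves upward, an operation of this type. The closure $\overline{\mathscr{A}}$ of $\mathscr{A}$ is $\mathscr{A}$ with, for every sort $t$ and every $c\in\mathscr{C}_t$, an additional nullary function symbol of value $c$. The flattening $\mathrm{Fl}(\mathscr{A})$ is $\mathscr{A}$ with, for every pre-expression over its signature, an additional function symbol of the same type whose operation is evaluation of that pre-expression. A subalgebra has the same set of sorts, a subset of the function symbols (with the same typing), subsets of the carriers, and the restricted operations (the carriers being closed under them). $\mathscr{B}$ is inherited from $\mathscr{A}$ if $\mathscr{B}$ is a subalgebra of $\mathrm{Fl}(\overline{\mathscr{A}})$. The algebra $\mathfrak{G}$. Its sorts are the elements of $\mathbb{N}$, its carriers are the $\mathfrak{G}_n$, and its operations are: (i) for all $n,m$, the disjoint sum $\oplus:\mathfrak{G}_n\times\mathfrak{G}_m\to\mathfrak{G}_{n+m}$ (disjoint union, terminals of the first graph followed by those of the second); (ii) for every map $\sigma:\{1,\dots,n\}\to\{1,\dots,m\}$ the terminal redefinition $\mathfrak{G}_m\to\mathfrak{G}_n$, $(G,t)\mapsto(G,t\circ\sigma)$; (iii) for $a,b\in\{1,\dots,n\}$ the fusion $\mathfrak{G}_n\to\mathfrak{G}_n$ identifying the vertices $t(a)$ and $t(b)$ (all edges kept, words and terminal map transported along the identification; the identity if $t(a)=t(b)$); (iv) the constant $\mathfrak{v}\in\mathfrak{G}_1$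 (one vertex, no edges, the vertex is the terminal) and for $n\ge1$ the constant $\mathfrak{e}_n\in\mathfrak{G}_n$ ($n$ distinct vertices $v_1,\dots,v_n$, one edge $e$ with $\langle e\rangle=v_1\cdots v_n$, $t(i)=v_i$). *)

theory Defs
  imports Main
begin

section \<open>Many-sorted algebras and recognisability\<close>

record ('s, 'f) signature =
  sorts :: "'s set"
  syms :: "'f set"
  inputs :: "'f \<Rightarrow> 's list"
  outsort :: "'f \<Rightarrow> 's"

definition wf_signature :: "('s, 'f) signature \<Rightarrow> bool" where
  "wf_signature S \<longleftrightarrow>
     (\<forall>f \<in> syms S. set (inputs S f) \<subseteq> sorts S \<and> outsort S f \<in> sorts S)"

record ('s, 'f, 'a) algebra =
  sig :: "('s, 'f) signature"
  carr :: "'s \<Rightarrow> 'a set"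
  oper :: "'f \<Rightarrow> 'a list \<Rightarrow> 'a"

definition args :: "('s, 'f, 'a) algebra \<Rightarrow> 's list \<Rightarrow> 'a list set" where
  "args A w = {xs. list_all2 (\<lambda>x t. x \<in> carr A t) xs w}"

definition is_algebra :: "('s, 'f, 'a) algebra \<Rightarrow> bool" where
  "is_algebra A \<longleftrightarrow>
     wf_signature (sig A) \<and>
     (\<forall>t \<in> sorts (sig A). \<forall>u \<in> sorts (sig A). t \<noteq> u \<longrightarrow> carr A t \<inter> carr A u = {}) \<and>
     (\<forall>f \<in> syms (sig A). \<forall>xs \<in> args A (inputs (sig A) f).
        oper A f xs \<in> carr A (outsort (sig A) f))"

definition locally_finite :: "('s, 'f, 'a) algebra \<Rightarrow> bool" where
  "locally_finite A \<longleftrightarrow> (\<forall>t \<in> sorts (sig A). finite (carr A t))"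

definition morphism ::
  "('s, 'f, 'a) algebra \<Rightarrow> ('s, 'f, 'b) algebra \<Rightarrow> ('s \<Rightarrow> 'a \<Rightarrow> 'b) \<Rightarrow> bool" where
  "morphism A B h \<longleftrightarrow>
     sig A = sig B \<and>
     (\<forall>t \<in> sorts (sig A). h t ` carr A t \<subseteq> carr B t) \<and>
     (\<forall>f \<in> syms (sig A). \<forall>xs \<in> args A (inputs (sig A) f).
        h (outsort (sig A) f) (oper A f xs) = oper B f (map2 h (inputs (sig A) f) xs))"

text \<open>
  HOL cannot quantify over the type of the elements of \<open>B\<close>.  Taking them from
  \<open>'s \<times> nat\<close> loses nothing: a locally finite algebra with sorts in \<open>'s\<close> has an isomorphic
  copy whose carrier of sort \<open>t\<close> is a finite subset of \<open>{t} \<times> UNIV\<close>.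
\<close>
definition recognisable :: "('s, 'f, 'a) algebra \<Rightarrow> 's \<Rightarrow> 'a set \<Rightarrow> bool" where
  "recognisable A t L \<longleftrightarrow>
     t \<in> sorts (sig A) \<and>
     (\<exists>(B :: ('s, 'f, 's \<times> nat) algebra) h M.
        is_algebra B \<and> locally_finite B \<and> morphism A B h \<and>
        M \<subseteq> carr B t \<and> L = {x \<in> carr A t. h t x \<in> M})"


section \<open>Inherited algebras\<close>

datatype 'f pre_exp = Node 'f "'f pre_exp list"

fun pe_outsort :: "('s, 'f) signature \<Rightarrow> 'f pre_exp \<Rightarrow> 's" where
  "pe_outsort S (Node f ts) = outsort S f"

fun pe_inputs :: "('s, 'f) signature \<Rightarrow> 'f pre_exp \<Rightarrow> 's list" where
  "pe_inputs S (Node f ts) =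
     (if ts = [] then inputs S f else concat (map (pe_inputs S) ts))"

fun pre_expression :: "('s, 'f) signature \<Rightarrow> 'f pre_exp \<Rightarrow> bool" where
  "pre_expression S (Node f ts) \<longleftrightarrow>
     f \<in> syms S \<and> (ts = [] \<or> map (pe_outsort S) ts = inputs S f) \<and>
     (\<forall>t \<in> set ts. pre_expression S t)"

text \<open>
  Each pair consists of an arity and an operation of that arity; the argument list is cut into
  consecutive blocks of these lengths, one block per operation.
\<close>
fun blockwise :: "(nat \<times> ('a list \<Rightarrow> 'a)) list \<Rightarrow> 'a list \<Rightarrow> 'a list" where
  "blockwise [] xs = []"
| "blockwise ((k, g) # gs) xs = g (take k xs) # blockwise gs (drop k xs)"

fun pe_eval :: "('s, 'f, 'a) algebra \<Rightarrow> 'f pre_exp \<Rightarrow> 'a list \<Rightarrow> 'a" where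
  "pe_eval A (Node f ts) =
     (\<lambda>xs. oper A f
        (if ts = [] then xs
         else blockwise (map (\<lambda>t. (length (pe_inputs (sig A) t), pe_eval A t)) ts) xs))"

definition alg_closure :: "('s, 'f, 'a) algebra \<Rightarrow> ('s, 'f + 's \<times> 'a, 'a) algebra" where
  "alg_closure A =
     \<lparr> sig = \<lparr> sorts = sorts (sig A),
               syms = syms (sig A) <+> (SIGMA t : sorts (sig A). carr A t),
               inputs = case_sum (inputs (sig A)) (\<lambda>_. []),
               outsort = case_sum (outsort (sig A)) fst \<rparr>,
       carr = carr A,
       oper = case_sum (oper A) (\<lambda>(t, c) _. c) \<rparr>"

definition flattening :: "('s, 'f, 'a) algebra \<Rightarrow> ('s, 'f + 'f pre_exp, 'a) algebra" where
  "flattening A =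
     \<lparr> sig = \<lparr> sorts = sorts (sig A),
               syms = syms (sig A) <+> {p. pre_expression (sig A) p},
               inputs = case_sum (inputs (sig A)) (pe_inputs (sig A)),
               outsort = case_sum (outsort (sig A)) (pe_outsort (sig A)) \<rparr>,
       carr = carr A,
       oper = case_sum (oper A) (pe_eval A) \<rparr>"

definition subalgebra :: "('s, 'f, 'a) algebra \<Rightarrow> ('s, 'f, 'a) algebra \<Rightarrow> bool" where
  "subalgebra B A \<longleftrightarrow>
     is_algebra B \<and>
     sorts (sig B) = sorts (sig A) \<and>
     syms (sig B) \<subseteq> syms (sig A) \<and>
     (\<forall>f \<in> syms (sig B). inputs (sig B) f = inputs (sig A) f \<and>
                         outsort (sig B) f = outsort (sig A) f) \<and>
     (\<forall>t \<in> sorts (sig A). carr B t \<subseteq> carr A t) \<and>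
     (\<forall>f \<in> syms (sig B). \<forall>xs \<in> args B (inputs (sig B) f). oper B f xs = oper A f xs)"

type_synonym ('s, 'f, 'a) inherited_sym =
  "('f + 's \<times> 'a) + ('f + 's \<times> 'a) pre_exp"

definition inherited ::
  "('s, ('s, 'f, 'a) inherited_sym, 'a) algebra \<Rightarrow> ('s, 'f, 'a) algebra \<Rightarrow> bool" where
  "inherited B A \<longleftrightarrow> subalgebra B (flattening (alg_closure A))"

lemma is_algebra_alg_closure: "is_algebra A \<Longrightarrow> is_algebra (alg_closure A)"
  by (auto simp: is_algebra_def wf_signature_def alg_closure_def args_def)

lemma args_append:
  "xs \<in> args A (v @ w) \<longleftrightarrow>
     take (length v) xs \<in> args A v \<and> drop (length v) xs \<in> args A w"
proof
  assume "xs \<in> args A (v @ w)"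
  then show "take (length v) xs \<in> args A v \<and> drop (length v) xs \<in> args A w"
    by (auto simp: args_def list_all2_append2 dest: list_all2_lengthD)
next
  assume "take (length v) xs \<in> args A v \<and> drop (length v) xs \<in> args A w"
  then have "take (length v) xs @ drop (length v) xs \<in> args A (v @ w)"
    unfolding args_def by (auto intro: list_all2_appendI simp del: append_take_drop_id)
  then show "xs \<in> args A (v @ w)" by simp
qed

lemma pe_eval_in_carr:
  assumes A: "is_algebra A"
  shows "pre_expression (sig A) p \<Longrightarrow> xs \<in> args A (pe_inputs (sig A) p) \<Longrightarrow>
    pe_eval A p xs \<in> carr A (pe_outsort (sig A) p)"
proof (induction p arbitrary: xs)
  case (Node f ts)
  have block: "blockwise (map (\<lambda>t. (length (pe_inputs (sig A) t), pe_eval A t)) us) ys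
      \<in> args A (map (pe_outsort (sig A)) us)"
    if "ys \<in> args A (concat (map (pe_inputs (sig A)) us))" "set us \<subseteq> set ts" for us ys
    using that
  proof (induction us arbitrary: ys)
    case Nil
    then show ?case by (simp add: args_def)
  next
    case (Cons u us)
    then have "pe_eval A u (take (length (pe_inputs (sig A) u)) ys) \<in> carr A (pe_outsort (sig A) u)"
      using Node.IH[of u] Node.prems(1) by (simp add: args_append)
    moreover have "blockwise (map (\<lambda>t. (length (pe_inputs (sig A) t), pe_eval A t)) us)
        (drop (length (pe_inputs (sig A) u)) ys) \<in> args A (map (pe_outsort (sig A)) us)"
      using Cons by (simp add: args_append)
    ultimately show ?case by (simp add: args_def)
  qed
  show ?case
    using Node.prems A block[of xs ts] by (auto simp: is_algebra_def split: if_splits)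
qed

lemma pe_sorts:
  assumes "wf_signature S"
  shows "pre_expression S p \<Longrightarrow> set (pe_inputs S p) \<subseteq> sorts S \<and> pe_outsort S p \<in> sorts S"
proof (induction p)
  case (Node f ts)
  then have "set (pe_inputs S t) \<subseteq> sorts S" if "t \<in> set ts" for t
    using that by simp
  moreover have "f \<in> syms S" using Node.prems by simp
  ultimately show ?case using assms unfolding wf_signature_def by (simp add: UN_least)
qed

lemma is_algebra_flattening:
  assumes "is_algebra A" shows "is_algebra (flattening A)"
proof -
  have "wf_signature (sig (flattening A))"
    using assms pe_sorts[of "sig A"]
    by (simp add: is_algebra_def wf_signature_def flattening_def Plus_def ball_Un)
  moreover have "args (flattening A) w = args A w" for w
    by (simp add: args_def flattening_def)
  ultimately show ?thesis
    using assms pe_eval_in_carr[OF assms]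
    by (auto simp: is_algebra_def flattening_def)
qed


section \<open>Concrete graphs with terminals\<close>

text \<open>
  A map from \<open>{1, \<dots>, n}\<close> is encoded as a list of length \<open>n\<close>, so terminals are numbered
  from \<open>0\<close>; the type of a graph is the length of its terminal list.
\<close>
record 'a graph =
  verts :: "'a set"
  edges :: "'a set"
  ends :: "'a \<Rightarrow> 'a list"
  terminals :: "'a list"

definition wf_graph :: "'a graph \<Rightarrow> bool" where
  "wf_graph G \<longleftrightarrow>
     finite (verts G) \<and> verts G \<noteq> {} \<and> finite (edges G) \<and> verts G \<inter> edges G = {} \<and>
     (\<forall>e \<in> edges G. ends G e \<noteq> [] \<and> set (ends G e) \<subseteq> verts G) \<and>
     set (terminals G) \<subseteq> verts G"

definition is_iso :: "('a \<Rightarrow> 'b) \<Rightarrow> ('a \<Rightarrow> 'b) \<Rightarrow> 'a graph \<Rightarrow> 'b graph \<Rightarrow> bool" where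
  "is_iso f g G H \<longleftrightarrow>
     bij_betw f (verts G) (verts H) \<and> bij_betw g (edges G) (edges H) \<and>
     (\<forall>e \<in> edges G. ends H (g e) = map f (ends G e)) \<and>
     terminals H = map f (terminals G)"

definition graph_iso :: "'a graph \<Rightarrow> 'b graph \<Rightarrow> bool" where
  "graph_iso G H \<longleftrightarrow> wf_graph G \<and> wf_graph H \<and> (\<exists>f g. is_iso f g G H)"


section \<open>Monadic second-order logic of graphs\<close>

text \<open>
  Individual variables and set variables are two separate copies of \<open>nat\<close>.
  \<open>Conn y xs\<close> is the atomic formula for \<open>m = length xs\<close>.
\<close>
datatype mso =
    Vert nat
  | Edge nat
  | Eq nat nat
  | Mem nat nat  \<comment> \<open>\<open>Mem X x\<close> stands for \<open>X(x)\<close>\<close>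
  | Conn nat "nat list"
  | Neg mso
  | And mso mso
  | All nat mso
  | AllSet nat mso

fun free_ind :: "mso \<Rightarrow> nat set" where
  "free_ind (Vert x) = {x}"
| "free_ind (Edge x) = {x}"
| "free_ind (Eq x y) = {x, y}"
| "free_ind (Mem X x) = {x}"
| "free_ind (Conn y xs) = insert y (set xs)"
| "free_ind (Neg \<phi>) = free_ind \<phi>"
| "free_ind (And \<phi> \<psi>) = free_ind \<phi> \<union> free_ind \<psi>"
| "free_ind (All x \<phi>) = free_ind \<phi> - {x}"
| "free_ind (AllSet X \<phi>) = free_ind \<phi>"

fun free_set :: "mso \<Rightarrow> nat set" where
  "free_set (Vert x) = {}"
| "free_set (Edge x) = {}"
| "free_set (Eq x y) = {}"
| "free_set (Mem X x) = {X}"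
| "free_set (Conn y xs) = {}"
| "free_set (Neg \<phi>) = free_set \<phi>"
| "free_set (And \<phi> \<psi>) = free_set \<phi> \<union> free_set \<psi>"
| "free_set (All x \<phi>) = free_set \<phi>"
| "free_set (AllSet X \<phi>) = free_set \<phi> - {X}"

definition sentence :: "mso \<Rightarrow> bool" where
  "sentence \<phi> \<longleftrightarrow> free_ind \<phi> = {} \<and> free_set \<phi> = {}"

definition inds :: "'a graph \<Rightarrow> 'a set" where
  "inds G = verts G \<union> edges G"

text \<open>Set variables range over sets of vertices and sets of edges, not over mixed sets.\<close>
definition vesets :: "'a graph \<Rightarrow> 'a set set" where
  "vesets G = Pow (verts G) \<union> Pow (edges G)"

fun sat :: "'a graph \<Rightarrow> (nat \<Rightarrow> 'a) \<Rightarrow> (nat \<Rightarrow> 'a set) \<Rightarrow> mso \<Rightarrow> bool" where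
  "sat G i s (Vert x) \<longleftrightarrow> i x \<in> verts G"
| "sat G i s (Edge x) \<longleftrightarrow> i x \<in> edges G"
| "sat G i s (Eq x y) \<longleftrightarrow> i x = i y"
| "sat G i s (Mem X x) \<longleftrightarrow> i x \<in> s X"
| "sat G i s (Conn y xs) \<longleftrightarrow> i y \<in> edges G \<and> ends G (i y) = map i xs"
| "sat G i s (Neg \<phi>) \<longleftrightarrow> \<not> sat G i s \<phi>"
| "sat G i s (And \<phi> \<psi>) \<longleftrightarrow> sat G i s \<phi> \<and> sat G i s \<psi>"
| "sat G i s (All x \<phi>) \<longleftrightarrow> (\<forall>a \<in> inds G. sat G (i(x := a)) s \<phi>)"
| "sat G i s (AllSet X \<phi>) \<longleftrightarrow> (\<forall>S \<in> vesets G. sat G i (s(X := S)) \<phi>)"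

definition graph_models :: "'a graph \<Rightarrow> mso \<Rightarrow> bool" where
  "graph_models G \<phi> \<longleftrightarrow>
     (\<forall>i s. range i \<subseteq> inds G \<longrightarrow> range s \<subseteq> vesets G \<longrightarrow> sat G i s \<phi>)"


section \<open>Graphs up to isomorphism\<close>

lemma graph_iso_refl: "wf_graph G \<Longrightarrow> graph_iso G G"
  unfolding graph_iso_def is_iso_def
  by (intro conjI exI[of _ id]) auto

lemma graph_iso_sym:
  assumes "graph_iso G H" shows "graph_iso H G"
proof -
  obtain f g where i: "is_iso f g G H" and wG: "wf_graph G" and wH: "wf_graph H"
    using assms by (auto simp: graph_iso_def)
  let ?f = "inv_into (verts G) f" and ?g = "inv_into (edges G) g"
  have inj: "inj_on f (verts G)" "inj_on g (edges G)"
    and im: "f ` verts G = verts H" "g ` edges G = edges H"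
    using i by (auto simp: is_iso_def bij_betw_def)
  have m: "map ?f (map f xs) = xs" if "set xs \<subseteq> verts G" for xs
    using that inj by (induction xs) auto
  have "is_iso ?f ?g H G"
    unfolding is_iso_def
  proof (intro conjI ballI)
    show "bij_betw ?f (verts H) (verts G)" "bij_betw ?g (edges H) (edges G)"
      using i by (auto simp: is_iso_def intro: bij_betw_inv_into)
    show "terminals G = map ?f (terminals H)"
      using i wG m by (simp add: is_iso_def wf_graph_def del: map_map)
  next
    fix e assume "e \<in> edges H"
    then obtain e' where e': "e' \<in> edges G" "e = g e'" using im by blast
    then show "ends G (?g e) = map ?f (ends H e)"
      using i wG m inj by (simp add: is_iso_def wf_graph_def del: map_map)
  qed
  then show ?thesis using wG wH by (auto simp: graph_iso_def)
qed

lemma graph_iso_trans: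
  assumes "graph_iso G H" "graph_iso H K" shows "graph_iso G K"
proof -
  obtain f g f' g' where "is_iso f g G H" "is_iso f' g' H K"
    using assms by (auto simp: graph_iso_def)
  then have "is_iso (f' \<circ> f) (g' \<circ> g) G K"
    unfolding is_iso_def by (auto intro: bij_betw_trans simp: bij_betw_apply)
  then show ?thesis using assms by (auto simp: graph_iso_def)
qed

definition vertex_pregraph :: "nat graph" where
  "vertex_pregraph = \<lparr> verts = {0}, edges = {}, ends = (\<lambda>_. []), terminals = [0] \<rparr>"

definition edge_pregraph :: "nat \<Rightarrow> nat graph" where
  "edge_pregraph n =
     \<lparr> verts = {..<n}, edges = {n}, ends = (\<lambda>_. [0..<n]), terminals = [0..<n] \<rparr>"

definition sum_pregraph :: "nat graph \<Rightarrow> nat graph \<Rightarrow> nat graph" where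
  "sum_pregraph G H =
     (let l = (\<lambda>x. 2 * x); r = (\<lambda>x. 2 * x + 1)
      in \<lparr> verts = l ` verts G \<union> r ` verts H,
           edges = l ` edges G \<union> r ` edges H,
           ends = (\<lambda>e. if even e then map l (ends G (e div 2)) else map r (ends H (e div 2))),
           terminals = map l (terminals G) @ map r (terminals H) \<rparr>)"

text \<open>
  Terminal redefinition and fusion are total here; the graph is left unchanged if an index is out
  of range, which does not happen for the symbols of the graph algebra.
\<close>
definition redef_pregraph :: "nat list \<Rightarrow> 'a graph \<Rightarrow> 'a graph" where
  "redef_pregraph \<sigma> G =
     (if set \<sigma> \<subseteq> {..<length (terminals G)}
      then G\<lparr> terminals := map (\<lambda>i. terminals G ! i) \<sigma> \<rparr> else G)"

definition fuse_pregraph :: "nat \<Rightarrow> nat \<Rightarrow> 'a graph \<Rightarrow> 'a graph" where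
  "fuse_pregraph a b G =
     (if a < length (terminals G) \<and> b < length (terminals G)
      then let r = (\<lambda>x. if x = terminals G ! b then terminals G ! a else x)
           in \<lparr> verts = r ` verts G, edges = edges G,
                ends = (\<lambda>e. map r (ends G e)), terminals = map r (terminals G) \<rparr>
      else G)"

lemma wf_vertex_pregraph: "wf_graph vertex_pregraph"
  by (auto simp: wf_graph_def vertex_pregraph_def)

lemma wf_edge_pregraph: "n \<ge> 1 \<Longrightarrow> wf_graph (edge_pregraph n)"
  by (auto simp: wf_graph_def edge_pregraph_def lessThan_empty_iff)

text \<open>
  Finite graphs have isomorphic copies with names in \<open>nat\<close>, so this type contains every
  isomorphism class of graphs with terminals.
\<close>
quotient_type tgraph = "nat graph" / partial: "graph_iso :: nat graph \<Rightarrow> nat graph \<Rightarrow> bool"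
proof (rule part_equivpI)
  show "\<exists>G :: nat graph. graph_iso G G"
    using wf_vertex_pregraph graph_iso_refl by blast
  show "symp (graph_iso :: nat graph \<Rightarrow> nat graph \<Rightarrow> bool)"
    by (auto intro: sympI graph_iso_sym)
  show "transp (graph_iso :: nat graph \<Rightarrow> nat graph \<Rightarrow> bool)"
    by (auto intro: transpI graph_iso_trans)
qed

lift_definition gtype :: "tgraph \<Rightarrow> nat" is "\<lambda>G. length (terminals G)"
  by (auto simp: graph_iso_def is_iso_def)

lift_definition vertex_graph :: tgraph is vertex_pregraph
  by (intro graph_iso_refl wf_vertex_pregraph)

text \<open>Only used for \<open>n \<ge> 1\<close>; for \<open>n = 0\<close> the edge would have no end points.\<close>
lift_definition edge_graph :: "nat \<Rightarrow> tgraph" is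
  "\<lambda>n. if n \<ge> 1 then edge_pregraph n else vertex_pregraph"
  by (simp add: graph_iso_refl wf_vertex_pregraph wf_edge_pregraph)

lemma wf_sum_pregraph:
  assumes "wf_graph G" "wf_graph H" shows "wf_graph (sum_pregraph G H)"
proof -
  have "2 * x \<noteq> Suc (2 * y)" "Suc (2 * y) \<noteq> 2 * x" for x y :: nat by presburger+
  moreover have "verts G \<inter> edges G = {}" "verts H \<inter> edges H = {}"
    using assms by (auto simp: wf_graph_def)
  ultimately have "verts (sum_pregraph G H) \<inter> edges (sum_pregraph G H) = {}"
    by (auto simp: sum_pregraph_def Let_def)
  moreover have "ends (sum_pregraph G H) e \<noteq> [] \<and>
      set (ends (sum_pregraph G H) e) \<subseteq> verts (sum_pregraph G H)"
    if "e \<in> edges (sum_pregraph G H)" for e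
  proof -
    have "e \<in> (\<lambda>x. 2 * x) ` edges G \<union> (\<lambda>x. 2 * x + 1) ` edges H"
      using that by (simp add: sum_pregraph_def Let_def)
    then consider e' where "e = 2 * e'" "e' \<in> edges G" | e' where "e = 2 * e' + 1" "e' \<in> edges H"
      by blast
    then show ?thesis
    proof cases
      case (1 e')
      then have "ends G e' \<noteq> []" "set (ends G e') \<subseteq> verts G"
        using assms by (auto simp: wf_graph_def)
      then show ?thesis using 1 by (auto simp: sum_pregraph_def Let_def)
    next
      case (2 e')
      then have "ends H e' \<noteq> []" "set (ends H e') \<subseteq> verts H"
        using assms by (auto simp: wf_graph_def)
      then show ?thesis using 2 by (auto simp: sum_pregraph_def Let_def)
    qed
  qed
  ultimately show ?thesis
    using assms by (auto simp: wf_graph_def sum_pregraph_def Let_def)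
qed

lemma bij_betw_parity:
  fixes f g :: "nat \<Rightarrow> nat"
  assumes "bij_betw f A A'" "bij_betw g B B'"
  shows "bij_betw (\<lambda>x. if even x then 2 * f (x div 2) else 2 * g (x div 2) + 1)
           ((\<lambda>x. 2 * x) ` A \<union> (\<lambda>x. 2 * x + 1) ` B) ((\<lambda>x. 2 * x) ` A' \<union> (\<lambda>x. 2 * x + 1) ` B')"
proof -
  let ?F = "\<lambda>x. if even x then 2 * f (x div 2) else 2 * g (x div 2) + 1"
  have "?F ` (\<lambda>x. 2 * x) ` A = (\<lambda>x. 2 * x) ` f ` A"
    unfolding image_image by (intro image_cong) auto
  then have "bij_betw ?F ((\<lambda>x. 2 * x) ` A) ((\<lambda>x. 2 * x) ` A')"
    using assms(1) by (auto simp: bij_betw_def inj_on_def)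
  moreover have "?F ` (\<lambda>x. 2 * x + 1) ` B = (\<lambda>x. 2 * x + 1) ` g ` B"
    unfolding image_image by (intro image_cong) auto
  then have "bij_betw ?F ((\<lambda>x. 2 * x + 1) ` B) ((\<lambda>x. 2 * x + 1) ` B')"
    using assms(2) by (auto simp: bij_betw_def inj_on_def)
  moreover have "(\<lambda>x. 2 * x) ` A' \<inter> (\<lambda>x. 2 * x + 1) ` B' = {}"
    by (auto dest: arg_cong[of _ _ even])
  ultimately show ?thesis by (rule bij_betw_combine)
qed

lemma sum_pregraph_iso:
  assumes "graph_iso G G'" "graph_iso H H'"
  shows "graph_iso (sum_pregraph G H) (sum_pregraph G' H')"
proof -
  obtain f1 g1 f2 g2 where i1: "is_iso f1 g1 G G'" and i2: "is_iso f2 g2 H H'"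
    using assms by (auto simp: graph_iso_def)
  have wf: "wf_graph (sum_pregraph G H)" "wf_graph (sum_pregraph G' H')"
    using assms by (auto simp: graph_iso_def intro: wf_sum_pregraph)
  define P where "P f f' x = (if even x then 2 * f (x div 2) else 2 * f' (x div 2) + 1)"
    for f f' :: "nat \<Rightarrow> nat" and x
  have "is_iso (P f1 f2) (P g1 g2) (sum_pregraph G H) (sum_pregraph G' H')"
    unfolding is_iso_def
  proof (intro conjI)
    show "bij_betw (P f1 f2) (verts (sum_pregraph G H)) (verts (sum_pregraph G' H'))"
      using bij_betw_parity[of f1 "verts G" "verts G'" f2 "verts H" "verts H'"] i1 i2
      by (simp add: is_iso_def sum_pregraph_def Let_def P_def[abs_def])
    show "bij_betw (P g1 g2) (edges (sum_pregraph G H)) (edges (sum_pregraph G' H'))"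
      using bij_betw_parity[of g1 "edges G" "edges G'" g2 "edges H" "edges H'"] i1 i2
      by (simp add: is_iso_def sum_pregraph_def Let_def P_def[abs_def])
    show "\<forall>e \<in> edges (sum_pregraph G H).
        ends (sum_pregraph G' H') (P g1 g2 e) = map (P f1 f2) (ends (sum_pregraph G H) e)"
      using i1 i2 by (auto simp: is_iso_def sum_pregraph_def Let_def P_def)
    show "terminals (sum_pregraph G' H') = map (P f1 f2) (terminals (sum_pregraph G H))"
      using i1 i2 by (auto simp: is_iso_def sum_pregraph_def Let_def P_def)
  qed
  then show ?thesis using wf by (auto simp: graph_iso_def)
qed

lift_definition sum_graph :: "tgraph \<Rightarrow> tgraph \<Rightarrow> tgraph" is sum_pregraph
  by (rule sum_pregraph_iso)

lemma terminal_in_verts: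
  "wf_graph G \<Longrightarrow> j < length (terminals G) \<Longrightarrow> terminals G ! j \<in> verts G"
  unfolding wf_graph_def by (meson nth_mem subsetD)

lemma wf_redef_pregraph:
  assumes "wf_graph G" shows "wf_graph (redef_pregraph \<sigma> G)"
proof -
  have "terminals G ! j \<in> verts G" if "j < length (terminals G)" for j
    using assms that by (rule terminal_in_verts)
  then show ?thesis
    using assms by (auto simp: wf_graph_def redef_pregraph_def)
qed

lemma redef_pregraph_iso:
  assumes "graph_iso G H"
  shows "graph_iso (redef_pregraph \<sigma> G) (redef_pregraph \<sigma> H)"
proof -
  obtain f g where i: "is_iso f g G H" and wf: "wf_graph G" "wf_graph H"
    using assms by (auto simp: graph_iso_def)
  have "is_iso f g (redef_pregraph \<sigma> G) (redef_pregraph \<sigma> H)"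
    using i by (auto simp: is_iso_def redef_pregraph_def)
  then show ?thesis using wf unfolding graph_iso_def by (metis wf_redef_pregraph)
qed

lift_definition redef_graph :: "nat list \<Rightarrow> tgraph \<Rightarrow> tgraph" is redef_pregraph
  by (rule redef_pregraph_iso)

lemma wf_fuse_pregraph:
  assumes "wf_graph G" shows "wf_graph (fuse_pregraph a b G)"
proof (cases "a < length (terminals G) \<and> b < length (terminals G)")
  case True
  then have V: "terminals G ! a \<in> verts G" "terminals G ! b \<in> verts G"
    using assms by (simp_all add: terminal_in_verts)
  define r where "r = (\<lambda>x. if x = terminals G ! b then terminals G ! a else x)"
  have G: "fuse_pregraph a b G =
      \<lparr> verts = r ` verts G, edges = edges G,
        ends = (\<lambda>e. map r (ends G e)), terminals = map r (terminals G) \<rparr>"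
    unfolding fuse_pregraph_def r_def Let_def using True by simp
  have rV: "r ` verts G \<subseteq> verts G" using V by (auto simp: r_def)
  have "r ` verts G \<inter> edges G = {}"
    using assms rV by (auto simp: wf_graph_def)
  moreover have "r ` set (ends G e) \<subseteq> r ` verts G" if "e \<in> edges G" for e
    using assms that by (intro image_mono) (auto simp: wf_graph_def)
  moreover have "r ` set (terminals G) \<subseteq> r ` verts G"
    using assms by (intro image_mono) (auto simp: wf_graph_def)
  ultimately show ?thesis
    using assms unfolding G by (simp add: wf_graph_def)
next
  case False
  then have "fuse_pregraph a b G = G" unfolding fuse_pregraph_def by (rule if_not_P)
  then show ?thesis using assms by simp
qed

lemma fuse_pregraph_iso:
  assumes "graph_iso G H"
  shows "graph_iso (fuse_pregraph a b G) (fuse_pregraph a b H)"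
proof (cases "a < length (terminals G) \<and> b < length (terminals G)")
  case True
  obtain f g where i: "is_iso f g G H" and wf: "wf_graph G" "wf_graph H"
    using assms by (auto simp: graph_iso_def)
  have len: "length (terminals H) = length (terminals G)"
    using i by (simp add: is_iso_def)
  define r where "r = (\<lambda>x. if x = terminals G ! b then terminals G ! a else x)"
  define r' where "r' = (\<lambda>x. if x = terminals H ! b then terminals H ! a else x)"
  have G: "fuse_pregraph a b G =
      \<lparr> verts = r ` verts G, edges = edges G,
        ends = (\<lambda>e. map r (ends G e)), terminals = map r (terminals G) \<rparr>"
    unfolding fuse_pregraph_def r_def Let_def using True by simp
  have H: "fuse_pregraph a b H =
      \<lparr> verts = r' ` verts H, edges = edges H,
        ends = (\<lambda>e. map r' (ends H e)), terminals = map r' (terminals H) \<rparr>"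
    unfolding fuse_pregraph_def r'_def Let_def using True len by simp
  have V: "terminals G ! a \<in> verts G" "terminals G ! b \<in> verts G"
    using True wf(1) by (simp_all add: terminal_in_verts)
  have inj: "inj_on f (verts G)" and im: "f ` verts G = verts H"
    using i by (auto simp: is_iso_def bij_betw_def)
  have comm: "r' (f x) = f (r x)" if "x \<in> verts G" for x
    using True i V that inj_onD[OF inj, of x "terminals G ! b"]
    by (auto simp: r_def r'_def is_iso_def)
  have rV: "r ` verts G \<subseteq> verts G" using V by (auto simp: r_def)
  have "r' ` verts H = f ` r ` verts G"
    unfolding im[symmetric] image_image using comm by (intro image_cong) auto
  then have "bij_betw f (r ` verts G) (r' ` verts H)"
    using inj rV by (auto simp: bij_betw_def intro: inj_on_subset)
  moreover have "map r' (map f xs) = map f (map r xs)" if "set xs \<subseteq> verts G" for xs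
    using that comm by (auto simp: subset_iff)
  ultimately have "is_iso f g (fuse_pregraph a b G) (fuse_pregraph a b H)"
    using i wf(1) unfolding G H by (simp add: is_iso_def wf_graph_def del: map_map)
  then show ?thesis
    using wf unfolding graph_iso_def by (metis wf_fuse_pregraph)
next
  case False
  moreover have "length (terminals H) = length (terminals G)"
    using assms by (auto simp: graph_iso_def is_iso_def)
  ultimately have "fuse_pregraph a b G = G" "fuse_pregraph a b H = H"
    unfolding fuse_pregraph_def by (metis if_not_P)+
  then show ?thesis using assms by simp
qed

lift_definition fuse_graph :: "nat \<Rightarrow> nat \<Rightarrow> tgraph \<Rightarrow> tgraph" is fuse_pregraph
  by (rule fuse_pregraph_iso)

lemma sat_iso:
  assumes V: "bij_betw h (verts G) (verts H)" and E: "bij_betw h (edges G) (edges H)"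
    and ends: "\<forall>e \<in> edges G. ends H (h e) = map h (ends G e)"
    and inj: "inj_on h (inds G)" and wf: "wf_graph G"
    and "range i \<subseteq> inds G" "range s \<subseteq> vesets G"
  shows "sat H (h \<circ> i) (\<lambda>X. h ` s X) \<phi> \<longleftrightarrow> sat G i s \<phi>"
  using assms(6,7)
proof (induction \<phi> arbitrary: i s)
  case (Vert x)
  then have "i x \<in> inds G" by auto
  then have "h (i x) \<in> h ` verts G \<longleftrightarrow> i x \<in> verts G"
    using inj_on_image_mem_iff[OF inj] by (auto simp: inds_def)
  then show ?case using V by (simp add: bij_betw_def)
next
  case (Edge x)
  then have "i x \<in> inds G" by auto
  then have "h (i x) \<in> h ` edges G \<longleftrightarrow> i x \<in> edges G"
    using inj_on_image_mem_iff[OF inj] by (auto simp: inds_def)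
  then show ?case using E by (simp add: bij_betw_def)
next
  case (Eq x y)
  then have "i x \<in> inds G" "i y \<in> inds G" by auto
  then show ?case using inj_on_eq_iff[OF inj] by simp
next
  case (Mem X x)
  then have "i x \<in> inds G" "s X \<subseteq> inds G" by (auto simp: inds_def vesets_def)
  then show ?case using inj_on_image_mem_iff[OF inj] by auto
next
  case (Conn y xs)
  then have "i y \<in> inds G" by auto
  then have e: "h (i y) \<in> edges H \<longleftrightarrow> i y \<in> edges G"
    using E inj_on_image_mem_iff[OF inj, of "i y" "edges G"] by (auto simp: bij_betw_def inds_def)
  have "map h (ends G (i y)) = map h (map i xs) \<longleftrightarrow> ends G (i y) = map i xs"
    if "i y \<in> edges G"
  proof (rule inj_on_map_eq_map, rule inj_on_subset[OF inj])
    show "set (ends G (i y)) \<union> set (map i xs) \<subseteq> inds G"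
      using Conn that wf by (auto simp: wf_graph_def inds_def)
  qed
  then show ?case using e ends by auto
next
  case (All x \<phi>)
  have im: "inds H = h ` inds G"
    using V E by (auto simp: inds_def bij_betw_def)
  have "sat H ((h \<circ> i)(x := h a)) (\<lambda>X. h ` s X) \<phi> \<longleftrightarrow> sat G (i(x := a)) s \<phi>"
    if "a \<in> inds G" for a
  proof -
    have "(h \<circ> i)(x := h a) = h \<circ> i(x := a)" by auto
    moreover have "range (i(x := a)) \<subseteq> inds G" using All.prems(1) that by auto
    ultimately show ?thesis using All.IH All.prems(2) by metis
  qed
  then show ?case unfolding sat.simps im by blast
next
  case (AllSet X \<phi>)
  have im: "vesets H = (`) h ` vesets G"
    using V E by (auto simp: vesets_def bij_betw_def image_Un image_Pow_surj)
  have "sat H (h \<circ> i) ((\<lambda>X. h ` s X)(X := h ` S)) \<phi> \<longleftrightarrow> sat G i (s(X := S)) \<phi>"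
    if "S \<in> vesets G" for S
  proof -
    have "(\<lambda>X. h ` s X)(X := h ` S) = (\<lambda>Y. h ` (s(X := S)) Y)" by (rule ext) simp
    moreover have "range (s(X := S)) \<subseteq> vesets G" using AllSet.prems(2) that by auto
    ultimately show ?thesis using AllSet.IH AllSet.prems(1) by metis
  qed
  then show ?case unfolding sat.simps im by blast
qed auto

lemma graph_models_iso_imp:
  assumes "graph_iso G H" and H: "graph_models H \<phi>"
  shows "graph_models G \<phi>"
  unfolding graph_models_def
proof (intro allI impI)
  fix i :: "nat \<Rightarrow> 'a" and s :: "nat \<Rightarrow> 'a set"
  assume rng: "range i \<subseteq> inds G" "range s \<subseteq> vesets G"
  obtain f g where fg: "is_iso f g G H" and wf: "wf_graph G" "wf_graph H"
    using assms by (auto simp: graph_iso_def)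
  define h where "h x = (if x \<in> verts G then f x else g x)" for x
  have hg: "h e = g e" if "e \<in> edges G" for e
    using that wf(1) by (auto simp: h_def wf_graph_def)
  have V: "bij_betw h (verts G) (verts H)"
    using fg bij_betw_cong[of "verts G" h f] by (auto simp: is_iso_def h_def)
  have E: "bij_betw h (edges G) (edges H)"
    using fg hg bij_betw_cong[of "edges G" h g] by (auto simp: is_iso_def)
  have bij: "bij_betw h (inds G) (inds H)"
    unfolding inds_def using V E wf(2) by (intro bij_betw_combine) (auto simp: wf_graph_def)
  have ends: "\<forall>e \<in> edges G. ends H (h e) = map h (ends G e)"
    using fg wf(1) hg by (fastforce simp: is_iso_def wf_graph_def h_def)
  have "range (h \<circ> i) \<subseteq> inds H"
    using rng(1) bij by (auto simp: bij_betw_def)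
  moreover have "range (\<lambda>X. h ` s X) \<subseteq> vesets H"
  proof -
    have "h ` S \<in> vesets H" if "S \<in> vesets G" for S
      using that V E unfolding vesets_def bij_betw_def by blast
    then show ?thesis using rng(2) by auto
  qed
  ultimately have "sat H (h \<circ> i) (\<lambda>X. h ` s X) \<phi>"
    using H by (simp add: graph_models_def)
  then show "sat G i s \<phi>"
    using sat_iso[OF V E ends _ wf(1) rng] bij by (auto simp: bij_betw_def)
qed

lemma graph_models_iso:
  assumes "graph_iso G H"
  shows "graph_models G \<phi> = graph_models H \<phi>"
  using graph_models_iso_imp[OF assms] graph_models_iso_imp[OF graph_iso_sym[OF assms]]
  by blast

lift_definition models :: "tgraph \<Rightarrow> mso \<Rightarrow> bool" is graph_models
  by (rule ext) (rule graph_models_iso)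


section \<open>The algebra of graphs\<close>

text \<open>\<open>Redef m \<sigma>\<close> turns graphs of type \<open>m\<close> into graphs of type \<open>length \<sigma>\<close>.\<close>
datatype gsym =
    Sum nat nat
  | Redef nat "nat list"
  | Fuse nat nat nat
  | VertexConst
  | EdgeConst nat

fun gsym_inputs :: "gsym \<Rightarrow> nat list" where
  "gsym_inputs (Sum n m) = [n, m]"
| "gsym_inputs (Redef m \<sigma>) = [m]"
| "gsym_inputs (Fuse n a b) = [n]"
| "gsym_inputs VertexConst = []"
| "gsym_inputs (EdgeConst n) = []"

fun gsym_outsort :: "gsym \<Rightarrow> nat" where
  "gsym_outsort (Sum n m) = n + m"
| "gsym_outsort (Redef m \<sigma>) = length \<sigma>"
| "gsym_outsort (Fuse n a b) = n"
| "gsym_outsort VertexConst = 1"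
| "gsym_outsort (EdgeConst n) = n"

fun gsym_oper :: "gsym \<Rightarrow> tgraph list \<Rightarrow> tgraph" where
  "gsym_oper (Sum n m) Gs = sum_graph (Gs ! 0) (Gs ! 1)"
| "gsym_oper (Redef m \<sigma>) Gs = redef_graph \<sigma> (Gs ! 0)"
| "gsym_oper (Fuse n a b) Gs = fuse_graph a b (Gs ! 0)"
| "gsym_oper VertexConst Gs = vertex_graph"
| "gsym_oper (EdgeConst n) Gs = edge_graph n"

definition graph_algebra :: "(nat, gsym, tgraph) algebra" where
  "graph_algebra =
     \<lparr> sig = \<lparr> sorts = UNIV,
               syms = {Sum n m | n m. True}
                      \<union> {Redef m \<sigma> | m \<sigma>. set \<sigma> \<subseteq> {..<m}}
                      \<union> {Fuse n a b | n a b. a < n \<and> b < n}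
                      \<union> {VertexConst}
                      \<union> {EdgeConst n | n. n \<ge> 1},
               inputs = gsym_inputs,
               outsort = gsym_outsort \<rparr>,
       carr = (\<lambda>n. {G. gtype G = n}),
       oper = gsym_oper \<rparr>"

lemma gtype_vertex_graph: "gtype vertex_graph = 1"
  by transfer (simp add: vertex_pregraph_def)

lemma gtype_edge_graph: "n \<ge> 1 \<Longrightarrow> gtype (edge_graph n) = n"
  by transfer (simp add: edge_pregraph_def)

lemma gtype_sum_graph: "gtype (sum_graph G H) = gtype G + gtype H"
  by transfer (simp add: sum_pregraph_def Let_def)

lemma gtype_redef_graph: "set \<sigma> \<subseteq> {..<gtype G} \<Longrightarrow> gtype (redef_graph \<sigma> G) = length \<sigma>"
  by transfer (simp add: redef_pregraph_def)

lemma gtype_fuse_graph: "gtype (fuse_graph a b G) = gtype G"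
  by transfer (simp add: fuse_pregraph_def Let_def)

lemma is_algebra_graph_algebra: "is_algebra graph_algebra"
proof -
  have "gtype (gsym_oper f xs) = gsym_outsort f"
    if "f \<in> syms (sig graph_algebra)" "xs \<in> args graph_algebra (gsym_inputs f)" for f xs
    using that
    by (cases f)
      (auto simp: graph_algebra_def args_def list_all2_Cons2 gtype_sum_graph gtype_redef_graph
        gtype_fuse_graph gtype_vertex_graph gtype_edge_graph)
  then show ?thesis
    by (auto simp: is_algebra_def wf_signature_def graph_algebra_def)
qed

lemma inherited_graph_algebra:
  "inherited (flattening (alg_closure graph_algebra)) graph_algebra"
  unfolding inherited_def subalgebra_def
  by (simp add: is_algebra_flattening is_algebra_alg_closure is_algebra_graph_algebra)

end

theory Submission
  imports Defs "HOL-Library.Countable"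
begin

text \<open>
  Only set variables are used in the Ehrenfeucht-Fraisse game: an individual is a singleton, and the
  atomic facts about a tuple of sets are inclusions, membership of terminals, and the existence of
  an edge in one set whose end points lie in prescribed sets.  Such facts pass to and from disjoint
  sums (by splitting the sets) and quotients (by taking preimages), and the sets of a fused graph
  correspond to the sets of the original graph that contain both or neither of the fused terminals.
  Hence equality of rank-\<open>k\<close> types is preserved by all operations, including evaluation of
  pre-expressions.  For a given sort there are finitely many types, and they decide every sentence of
  smaller quantifier depth, so the quotient by this congruence recognises its set of models.
\<close>

section \<open>Congruences of finite index\<close>

text \<open>A congruence is given by a sorted family \<open>c\<close> of invariants, its kernel being the relation.\<close>
definition congruence :: "('s, 'f, 'a) algebra \<Rightarrow> ('s \<Rightarrow> 'a \<Rightarrow> 'c) \<Rightarrow> bool" where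
  "congruence A c \<longleftrightarrow>
     (\<forall>f \<in> syms (sig A). \<forall>xs \<in> args A (inputs (sig A) f). \<forall>ys \<in> args A (inputs (sig A) f).
        map2 c (inputs (sig A) f) xs = map2 c (inputs (sig A) f) ys \<longrightarrow>
        c (outsort (sig A) f) (oper A f xs) = c (outsort (sig A) f) (oper A f ys))"

lemma congruenceD:
  "congruence A c \<Longrightarrow> f \<in> syms (sig A) \<Longrightarrow>
    xs \<in> args A (inputs (sig A) f) \<Longrightarrow> ys \<in> args A (inputs (sig A) f) \<Longrightarrow>
    map2 c (inputs (sig A) f) xs = map2 c (inputs (sig A) f) ys \<Longrightarrow>
    c (outsort (sig A) f) (oper A f xs) = c (outsort (sig A) f) (oper A f ys)"
  unfolding congruence_def by blast

lemma length_args: "xs \<in> args A w \<Longrightarrow> length xs = length w"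
  unfolding args_def mem_Collect_eq by (rule list_all2_lengthD)

section \<open>Congruences under closure, flattening and subalgebras\<close>

lemma congruence_alg_closure:
  assumes "congruence A c"
  shows "congruence (alg_closure A) c"
  unfolding congruence_def
proof (intro ballI impI)
  fix f xs ys
  assume f: "f \<in> syms (sig (alg_closure A))"
    and xs: "xs \<in> args (alg_closure A) (inputs (sig (alg_closure A)) f)"
    and ys: "ys \<in> args (alg_closure A) (inputs (sig (alg_closure A)) f)"
    and eq: "map2 c (inputs (sig (alg_closure A)) f) xs = map2 c (inputs (sig (alg_closure A)) f) ys"
  have args: "args (alg_closure A) w = args A w" for w
    by (simp add: args_def alg_closure_def)
  show "c (outsort (sig (alg_closure A)) f) (oper (alg_closure A) f xs) =
      c (outsort (sig (alg_closure A)) f) (oper (alg_closure A) f ys)"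
  proof (cases f)
    case (Inl g)
    then have "g \<in> syms (sig A)" using f by (auto simp: alg_closure_def)
    from congruenceD[OF assms this, of xs ys] show ?thesis
      using Inl xs ys eq unfolding args by (simp add: alg_closure_def)
  next
    case (Inr z)
    then show ?thesis by (simp add: alg_closure_def case_prod_unfold)
  qed
qed

text \<open>\<open>blockwise\<close> hands the first block of arguments to the first subtree and the
  rest to the others; the equality of invariants has to be cut at the same place.\<close>

lemma map2_append_split:
  assumes "length xs = length v + length w" "length ys = length v + length w"
    and "map2 c (v @ w) xs = map2 c (v @ w) ys"
  shows "map2 c v (take (length v) xs) = map2 c v (take (length v) ys)"
    and "map2 c w (drop (length v) xs) = map2 c w (drop (length v) ys)"
proof -
  have "map2 c (v @ w) zs = map2 c v (take (length v) zs) @ map2 c w (drop (length v) zs)"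
    for zs by (simp add: zip_append1)
  then show "map2 c v (take (length v) xs) = map2 c v (take (length v) ys)"
    and "map2 c w (drop (length v) xs) = map2 c w (drop (length v) ys)"
    using assms by auto
qed

lemma congruence_pe_eval:
  assumes A: "is_algebra A" and c: "congruence A c"
  shows "pre_expression (sig A) p \<Longrightarrow>
    xs \<in> args A (pe_inputs (sig A) p) \<Longrightarrow> ys \<in> args A (pe_inputs (sig A) p) \<Longrightarrow>
    map2 c (pe_inputs (sig A) p) xs = map2 c (pe_inputs (sig A) p) ys \<Longrightarrow>
    c (pe_outsort (sig A) p) (pe_eval A p xs) = c (pe_outsort (sig A) p) (pe_eval A p ys)"
proof (induction p arbitrary: xs ys)
  case (Node f ts)
  let ?g = "\<lambda>t. (length (pe_inputs (sig A) t), pe_eval A t)"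
  \<comment> \<open>Evaluates a list of subtrees side by side. Membership in the carriers is carried
    along, since the congruence at the root applies only to genuine argument tuples;
    \<open>us\<close> ranges over parts of \<open>ts\<close> so that the induction on the list keeps
    access to the outer induction hypotheses.\<close>
  have block: "blockwise (map ?g us) xs \<in> args A (map (pe_outsort (sig A)) us) \<and>
      blockwise (map ?g us) ys \<in> args A (map (pe_outsort (sig A)) us) \<and>
      map2 c (map (pe_outsort (sig A)) us) (blockwise (map ?g us) xs) =
      map2 c (map (pe_outsort (sig A)) us) (blockwise (map ?g us) ys)"
    if "set us \<subseteq> set ts"
      "xs \<in> args A (concat (map (pe_inputs (sig A)) us))"
      "ys \<in> args A (concat (map (pe_inputs (sig A)) us))"
      "map2 c (concat (map (pe_inputs (sig A)) us)) xs =
       map2 c (concat (map (pe_inputs (sig A)) us)) ys" for us xs ys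
    using that
  proof (induction us arbitrary: xs ys)
    case Nil
    then show ?case by (simp add: args_def)
  next
    case (Cons u us)
    let ?v = "pe_inputs (sig A) u" and ?w = "concat (map (pe_inputs (sig A)) us)"
    have u: "u \<in> set ts" "pre_expression (sig A) u"
      using Cons.prems(1) Node.prems(1) by auto
    have len: "length xs = length ?v + length ?w" "length ys = length ?v + length ?w"
      using Cons.prems(2,3)[THEN length_args] by auto
    have eq: "map2 c (?v @ ?w) xs = map2 c (?v @ ?w) ys" using Cons.prems(4) by simp
    have xs: "take (length ?v) xs \<in> args A ?v" "drop (length ?v) xs \<in> args A ?w"
      and ys: "take (length ?v) ys \<in> args A ?v" "drop (length ?v) ys \<in> args A ?w"
      using Cons.prems(2,3) by (simp_all add: args_append)
    have "c (pe_outsort (sig A) u) (pe_eval A u (take (length ?v) xs)) =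
        c (pe_outsort (sig A) u) (pe_eval A u (take (length ?v) ys))"
      using Node.IH[OF u xs(1) ys(1)] map2_append_split(1)[OF len eq] by blast
    moreover have "pe_eval A u (take (length ?v) xs) \<in> carr A (pe_outsort (sig A) u)"
      "pe_eval A u (take (length ?v) ys) \<in> carr A (pe_outsort (sig A) u)"
      using pe_eval_in_carr[OF A u(2)] xs(1) ys(1) by auto
    moreover note Cons.IH[OF _ xs(2) ys(2) map2_append_split(2)[OF len eq]]
    ultimately show ?case using Cons.prems(1) by (simp add: args_def)
  qed
  show ?case
  proof (cases "ts = []")
    \<comment> \<open>A vertex without children is a leaf whatever the arity of \<open>f\<close>, so
      its arguments go to \<open>f\<close> directly.\<close>
    case True
    then show ?thesis using Node.prems congruenceD[OF c, of f xs ys] by simp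
  next
    case False
    have "xs \<in> args A (concat (map (pe_inputs (sig A)) ts))"
      "ys \<in> args A (concat (map (pe_inputs (sig A)) ts))"
      "map2 c (concat (map (pe_inputs (sig A)) ts)) xs =
       map2 c (concat (map (pe_inputs (sig A)) ts)) ys"
      using Node.prems(2-4) False by simp_all
    note bl = block[OF subset_refl this]
    have "f \<in> syms (sig A)" "map (pe_outsort (sig A)) ts = inputs (sig A) f"
      using Node.prems(1) False by simp_all
    then show ?thesis using congruenceD[OF c, of f] bl False by simp
  qed
qed

lemma congruence_flattening:
  assumes "is_algebra A" "congruence A c"
  shows "congruence (flattening A) c"
  unfolding congruence_def
proof (intro ballI impI)
  fix f xs ys
  assume f: "f \<in> syms (sig (flattening A))"
    and xs: "xs \<in> args (flattening A) (inputs (sig (flattening A)) f)"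
    and ys: "ys \<in> args (flattening A) (inputs (sig (flattening A)) f)"
    and eq: "map2 c (inputs (sig (flattening A)) f) xs = map2 c (inputs (sig (flattening A)) f) ys"
  have args: "args (flattening A) w = args A w" for w
    by (simp add: args_def flattening_def)
  show "c (outsort (sig (flattening A)) f) (oper (flattening A) f xs) =
      c (outsort (sig (flattening A)) f) (oper (flattening A) f ys)"
  proof (cases f)
    case (Inl g)
    then have "g \<in> syms (sig A)" using f by (auto simp: flattening_def)
    from congruenceD[OF assms(2) this, of xs ys] show ?thesis
      using Inl xs ys eq unfolding args by (simp add: flattening_def)
  next
    case (Inr p)
    then have "pre_expression (sig A) p" using f by (auto simp: flattening_def)
    from congruence_pe_eval[OF assms this, of xs ys] show ?thesis
      using Inr xs ys eq unfolding args by (simp add: flattening_def)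
  qed
qed

lemma congruence_subalgebra:
  assumes B: "subalgebra B A" and A: "is_algebra A" and c: "congruence A c"
  shows "congruence B c"
  unfolding congruence_def
proof (intro ballI impI)
  fix f xs ys
  assume f: "f \<in> syms (sig B)"
    and xs: "xs \<in> args B (inputs (sig B) f)" and ys: "ys \<in> args B (inputs (sig B) f)"
    and eq: "map2 c (inputs (sig B) f) xs = map2 c (inputs (sig B) f) ys"
  have fA: "f \<in> syms (sig A)" "inputs (sig B) f = inputs (sig A) f"
    "outsort (sig B) f = outsort (sig A) f"
    using B f by (auto simp: subalgebra_def)
  \<comment> \<open>\<open>subalgebra\<close> compares carriers only at sorts, so the inputs of
    \<open>f\<close> must be known to be sorts.\<close>
  have sub: "set (inputs (sig A) f) \<subseteq> sorts (sig A)"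
    using A fA(1) by (auto simp: is_algebra_def wf_signature_def)
  have carr: "carr B t \<subseteq> carr A t" if "t \<in> sorts (sig A)" for t
    using B that by (auto simp: subalgebra_def)
  have "zs \<in> args A (inputs (sig A) f)" if "zs \<in> args B (inputs (sig A) f)" for zs
    using that sub carr unfolding args_def mem_Collect_eq
    by (elim list.rel_mono_strong) blast
  then have "xs \<in> args A (inputs (sig A) f)" "ys \<in> args A (inputs (sig A) f)"
    using xs ys fA by auto
  then have "c (outsort (sig A) f) (oper A f xs) = c (outsort (sig A) f) (oper A f ys)"
    using congruenceD[OF c fA(1)] eq unfolding fA by blast
  moreover have "oper B f xs = oper A f xs" "oper B f ys = oper A f ys"
    using B f xs ys by (auto simp: subalgebra_def)
  ultimately show "c (outsort (sig B) f) (oper B f xs) = c (outsort (sig B) f) (oper B f ys)"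
    using fA by simp
qed

text \<open>The recognising algebra is the quotient by the congruence. Representing a class by the
  number that \<open>c\<close> gives it, tagged with its sort, fits the carrier type demanded by
  \<open>recognisable\<close> and makes carriers of distinct sorts disjoint. The last assumption
  says that \<open>L\<close> is a union of classes.\<close>

lemma recognisable_congruence:
  fixes c :: "'s \<Rightarrow> 'a \<Rightarrow> nat"
  assumes A: "is_algebra A" and c: "congruence A c"
    and fin: "\<And>u. u \<in> sorts (sig A) \<Longrightarrow> finite (c u ` carr A u)"
    and t: "t \<in> sorts (sig A)" and L: "L \<subseteq> carr A t"
    and sat: "\<And>x y. x \<in> L \<Longrightarrow> y \<in> carr A t \<Longrightarrow> c t x = c t y \<Longrightarrow> y \<in> L"
  shows "recognisable A t L"
proof -
  define h where "h u x = (u, c u x)" for u x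
  \<comment> \<open>Operations of the quotient act on chosen representatives;
    \<open>congruence\<close> makes the class of the result independent of the choice.\<close>
  define lift where "lift f ys =
    (SOME xs. xs \<in> args A (inputs (sig A) f) \<and> map2 h (inputs (sig A) f) xs = ys)" for f ys
  define B where "B = \<lparr> sig = sig A, carr = (\<lambda>u. h u ` carr A u),
    oper = (\<lambda>f ys. h (outsort (sig A) f) (oper A f (lift f ys))) \<rparr>"
  have lift: "lift f (map2 h (inputs (sig A) f) xs) \<in> args A (inputs (sig A) f) \<and>
      map2 h (inputs (sig A) f) (lift f (map2 h (inputs (sig A) f) xs)) =
      map2 h (inputs (sig A) f) xs"
    if "xs \<in> args A (inputs (sig A) f)" for f xs
    unfolding lift_def by (rule someI[of _ xs]) (use that in simp)
  have c_h: "map2 c w xs = map snd (map2 h w xs)" for w xs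
    by (simp add: h_def case_prod_unfold)
  have argsB: "\<exists>xs. xs \<in> args A w \<and> ys = map2 h w xs" if "ys \<in> args B w" for ys w
    using that
  proof (induction w arbitrary: ys)
    case Nil
    then show ?case by (simp add: args_def)
  next
    case (Cons u w)
    then obtain y ys' where ys: "ys = y # ys'" "y \<in> carr B u" "ys' \<in> args B w"
      by (auto simp: args_def list_all2_Cons2)
    obtain x where "x \<in> carr A u" "y = h u x" using ys(2) by (auto simp: B_def)
    moreover obtain xs where "xs \<in> args A w" "ys' = map2 h w xs" using Cons.IH ys(3) by blast
    ultimately have "x # xs \<in> args A (u # w) \<and> ys = map2 h (u # w) (x # xs)"
      using ys by (simp add: args_def)
    then show ?case by blast
  qed
  have "is_algebra B"
    unfolding is_algebra_def
  proof (intro conjI ballI impI)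
    show "wf_signature (sig B)" using A by (simp add: is_algebra_def B_def)
    show "carr B u \<inter> carr B v = {}" if "u \<noteq> v" for u v
      using that by (auto simp: B_def h_def)
  next
    fix f ys assume f: "f \<in> syms (sig B)" and "ys \<in> args B (inputs (sig B) f)"
    then obtain xs where "xs \<in> args A (inputs (sig A) f)" "ys = map2 h (inputs (sig A) f) xs"
      using argsB by (auto simp: B_def)
    then have "lift f ys \<in> args A (inputs (sig A) f)" using lift by blast
    then show "oper B f ys \<in> carr B (outsort (sig B) f)"
      using A f by (simp add: is_algebra_def B_def)
  qed
  moreover have "locally_finite B"
  proof -
    have "h u ` carr A u = Pair u ` c u ` carr A u" for u
      unfolding h_def image_image ..
    then show ?thesis using fin by (simp add: locally_finite_def B_def)
  qed
  moreover have "morphism A B h"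
    unfolding morphism_def
  proof (intro conjI ballI)
    fix f xs assume f: "f \<in> syms (sig A)" and xs: "xs \<in> args A (inputs (sig A) f)"
    let ?w = "inputs (sig A) f"
    have "map2 c ?w (lift f (map2 h ?w xs)) = map2 c ?w xs"
      unfolding c_h using lift[OF xs] by simp
    then have "c (outsort (sig A) f) (oper A f (lift f (map2 h ?w xs))) =
        c (outsort (sig A) f) (oper A f xs)"
      using congruenceD[OF c f] xs lift[OF xs] by blast
    then show "h (outsort (sig A) f) (oper A f xs) = oper B f (map2 h ?w xs)"
      by (simp add: B_def h_def)
  qed (auto simp: B_def)
  moreover have "h t ` L \<subseteq> carr B t" using L by (auto simp: B_def)
  \<comment> \<open>The accepting set is the image of \<open>L\<close>; saturation makes
    \<open>L\<close> its full preimage.\<close>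
  moreover have "L = {x \<in> carr A t. h t x \<in> h t ` L}"
  proof -
    have "x \<in> L" if "x \<in> carr A t" "y \<in> L" "c t y = c t x" for x y
      using sat that by blast
    then show ?thesis using L by (auto simp: h_def)
  qed
  ultimately show ?thesis using t unfolding recognisable_def by blast
qed

section \<open>Monadic types of graphs\<close>

text \<open>
  In \<open>Incid\<close> the individuals of \<open>Conn\<close> are replaced by sets; the two agree on singletons.
  There is no atom for singletons, which would not be compatible with fusion.
\<close>
datatype atom =
    Subset nat nat
  | NoEdge nat
  | NoVert nat
  | TermIn nat nat
  | Incid nat "nat list"

instance atom :: countable
  by countable_datatype

text \<open>In a well-formed graph, \<open>NoEdge\<close> on a singleton of the graph means being a
  vertex and \<open>NoVert\<close> being an edge; on any set, at least one of the two holds exactly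
  if its part inside the graph lies in \<open>vesets G\<close>. The sets in \<open>Ps\<close> may
  contain points outside the graph, hence the intersection in \<open>Subset\<close>.\<close>

fun holds :: "'a graph \<Rightarrow> 'a set list \<Rightarrow> atom \<Rightarrow> bool" where
  "holds G Ps (Subset i j) \<longleftrightarrow> Ps ! i \<inter> inds G \<subseteq> Ps ! j"
| "holds G Ps (NoEdge i) \<longleftrightarrow> Ps ! i \<inter> edges G = {}"
| "holds G Ps (NoVert i) \<longleftrightarrow> Ps ! i \<inter> verts G = {}"
| "holds G Ps (TermIn a i) \<longleftrightarrow> terminals G ! a \<in> Ps ! i"
| "holds G Ps (Incid y xs) \<longleftrightarrow>
     (\<exists>e \<in> edges G. e \<in> Ps ! y \<and> list_all2 (\<lambda>v x. v \<in> Ps ! x) (ends G e) xs)"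

text \<open>\<open>M\<close> bounds the length of the words in \<open>Incid\<close>, which keeps the
  set of atoms finite although edges may have any number of end points. A formula needs only the
  lengths that occur in its \<open>Conn\<close> atoms.\<close>

definition atoms :: "nat \<Rightarrow> nat \<Rightarrow> nat \<Rightarrow> atom set" where
  "atoms M n j =
     (\<lambda>(i, i'). Subset i i') ` ({..<j} \<times> {..<j}) \<union> NoEdge ` {..<j} \<union> NoVert ` {..<j} \<union>
     (\<lambda>(a, i). TermIn a i) ` ({..<n} \<times> {..<j}) \<union>
     (\<lambda>(y, xs). Incid y xs) ` ({..<j} \<times> {xs. set xs \<subseteq> {..<j} \<and> length xs \<le> M})"

lemma finite_atoms: "finite (atoms M n j)"
  by (simp add: atoms_def finite_lists_length_le)

lemma atoms_simps [simp]:
  "Subset i i' \<in> atoms M n j \<longleftrightarrow> i < j \<and> i' < j"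
  "NoEdge i \<in> atoms M n j \<longleftrightarrow> i < j"
  "NoVert i \<in> atoms M n j \<longleftrightarrow> i < j"
  "TermIn a i \<in> atoms M n j \<longleftrightarrow> a < n \<and> i < j"
  "Incid y xs \<in> atoms M n j \<longleftrightarrow> y < j \<and> set xs \<subseteq> {..<j} \<and> length xs \<le> M"
  by (auto simp: atoms_def)

text \<open>
  The Ehrenfeucht-Fraisse type of rank \<open>k\<close> of a graph with distinguished sets, coded as a number.
  Letting the moves be arbitrary sets, of which only the part inside the graph matters, avoids side
  conditions on \<open>Ps\<close>.
\<close>
fun mtype :: "nat \<Rightarrow> nat \<Rightarrow> 'a graph \<Rightarrow> 'a set list \<Rightarrow> nat" where
  "mtype M 0 G Ps =
     set_encode (to_nat ` {\<alpha> \<in> atoms M (length (terminals G)) (length Ps). holds G Ps \<alpha>})"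
| "mtype M (Suc k) G Ps = set_encode (range (\<lambda>S. mtype M k G (Ps @ [S])))"

text \<open>A type of rank \<open>Suc k\<close> codes a subset of the finite set of types of rank
  \<open>k\<close> with one more distinguished set. That the bound is uniform in the graph yields
  the finite index of the congruence.\<close>

lemma mtype_bounded:
  "\<exists>T. finite T \<and> (\<forall>(G :: 'a graph) Ps. length (terminals G) = n \<longrightarrow> length Ps = j \<longrightarrow> mtype M k G Ps \<in> T)"
proof (induction k arbitrary: j)
  case 0
  show ?case
    by (rule exI[of _ "(\<lambda>F. set_encode (to_nat ` F)) ` Pow (atoms M n j)"])
      (auto simp: finite_atoms)
next
  case (Suc k)
  then obtain T where T: "finite T"
    "\<forall>(G :: 'a graph) Ps. length (terminals G) = n \<longrightarrow> length Ps = Suc j \<longrightarrow> mtype M k G Ps \<in> T"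
    by blast
  show ?case
    by (rule exI[of _ "set_encode ` Pow T"]) (use T in auto)
qed

text \<open>\<open>set_encode\<close> is injective on finite sets only; there may be infinitely many
  moves \<open>S\<close>, but they realise finitely many types.\<close>

lemma finite_mtype_moves:
  fixes G :: "'a graph"
  shows "finite (range (\<lambda>S. mtype M k G (Ps @ [S])))"
proof -
  obtain T where T: "finite T"
    "\<forall>(H :: 'a graph) Qs. length (terminals H) = length (terminals G) \<longrightarrow>
      length Qs = Suc (length Ps) \<longrightarrow> mtype M k H Qs \<in> T"
    using mtype_bounded[of "length (terminals G)" "Suc (length Ps)" M k] by blast
  have "range (\<lambda>S. mtype M k G (Ps @ [S])) \<subseteq> T"
    by (intro image_subsetI T(2)[rule_format]) simp_all
  then show ?thesis using T(1) by (rule finite_subset)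
qed

section \<open>Back-and-forth moves\<close>

lemma mtype_Suc_eq:
  "mtype M (Suc k) G Ps = mtype M (Suc k) H Qs \<longleftrightarrow>
     range (\<lambda>S. mtype M k G (Ps @ [S])) = range (\<lambda>S. mtype M k H (Qs @ [S]))"
  by (simp add: set_encode_eq finite_mtype_moves)

lemma mtype_move:
  assumes "mtype M (Suc k) G Ps = mtype M (Suc k) H Qs"
  obtains S' where "mtype M k G (Ps @ [S]) = mtype M k H (Qs @ [S'])"
  using assms unfolding mtype_Suc_eq by blast

lemma mtype_Suc_eqI:
  assumes "\<And>S. \<exists>S'. mtype M k G (Ps @ [S]) = mtype M k H (Qs @ [S'])"
    and "\<And>S'. \<exists>S. mtype M k H (Qs @ [S']) = mtype M k G (Ps @ [S])"
  shows "mtype M (Suc k) G Ps = mtype M (Suc k) H Qs"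
  unfolding mtype_Suc_eq
proof (intro subset_antisym image_subsetI)
  fix S show "mtype M k G (Ps @ [S]) \<in> range (\<lambda>S. mtype M k H (Qs @ [S]))"
    using assms(1)[of S] by (elim exE) simp
next
  fix S show "mtype M k H (Qs @ [S]) \<in> range (\<lambda>S. mtype M k G (Ps @ [S]))"
    using assms(2)[of S] by (elim exE) simp
qed

lemma holds_append:
  assumes "\<alpha> \<in> atoms M n (length Ps)"
  shows "holds G (Ps @ Qs) \<alpha> \<longleftrightarrow> holds G Ps \<alpha>"
proof (cases \<alpha>)
  case (Incid y xs)
  have "list_all2 (\<lambda>v x. v \<in> (Ps @ Qs) ! x) vs xs \<longleftrightarrow> list_all2 (\<lambda>v x. v \<in> Ps ! x) vs xs" for vs
    using assms Incid by (intro list.rel_cong) (auto simp: nth_append)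
  then show ?thesis using assms Incid by (auto simp: nth_append)
qed (use assms in \<open>auto simp: nth_append\<close>)

text \<open>Moves append sets and leave the earlier ones in place, so equality at any rank descends
  to rank 0 along arbitrary moves without affecting the atoms about \<open>Ps\<close> and
  \<open>Qs\<close>.\<close>

lemma mtype_holds:
  assumes "mtype M k G Ps = mtype M k H Qs"
    and "length (terminals G) = length (terminals H)" "length Ps = length Qs"
    and "\<alpha> \<in> atoms M (length (terminals H)) (length Qs)"
  shows "holds G Ps \<alpha> \<longleftrightarrow> holds H Qs \<alpha>"
  using assms
proof (induction k arbitrary: Ps Qs)
  case 0
  then have "{\<alpha> \<in> atoms M (length (terminals H)) (length Qs). holds G Ps \<alpha>} =
    {\<alpha> \<in> atoms M (length (terminals H)) (length Qs). holds H Qs \<alpha>}"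
    by (simp add: set_encode_eq finite_atoms inj_image_eq_iff)
  then show ?case using 0 by blast
next
  case (Suc k)
  \<comment> \<open>The empty set is a dummy move.\<close>
  obtain S' where S': "mtype M k G (Ps @ [{}]) = mtype M k H (Qs @ [S'])"
    using Suc.prems(1) by (rule mtype_move)
  have "\<alpha> \<in> atoms M (length (terminals H)) (length (Qs @ [S']))"
    using Suc.prems(4) by (cases \<alpha>) auto
  then have "holds G (Ps @ [{}]) \<alpha> \<longleftrightarrow> holds H (Qs @ [S']) \<alpha>"
    using Suc.IH[OF S'] Suc.prems by simp
  then show ?case using holds_append Suc.prems by metis
qed

lemma mtype_0_eqI:
  assumes "length (terminals G) = length (terminals H)" "length Ps = length Qs"
    and "\<And>\<alpha>. \<alpha> \<in> atoms M (length (terminals H)) (length Qs) \<Longrightarrow> holds G Ps \<alpha> \<longleftrightarrow> holds H Qs \<alpha>"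
  shows "mtype M 0 G Ps = mtype M 0 H Qs"
proof -
  have "{\<alpha> \<in> atoms M (length (terminals H)) (length Qs). holds G Ps \<alpha>} =
    {\<alpha> \<in> atoms M (length (terminals H)) (length Qs). holds H Qs \<alpha>}"
    using assms(3) by blast
  then show ?thesis using assms(1,2) by simp
qed

section \<open>Types determine truth\<close>

text \<open>
  A nonempty set is a singleton iff each of its nonempty subsets contains it, so one further move
  detects it.
\<close>
lemma mtype_singleton:
  assumes "mtype M (Suc k) G (Ps @ [S]) = mtype M (Suc k) H (Qs @ [S'])"
    and "length (terminals G) = length (terminals H)" "length Ps = length Qs"
    and disj: "verts G \<inter> edges G = {}" "verts H \<inter> edges H = {}"
    and S: "S \<inter> inds G = {a}"
  obtains a' where "a' \<in> inds H" "S' \<inter> inds H = {a'}"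
proof -
  let ?j = "length Qs"
  have at: "holds G (Ps @ [S]) \<alpha> \<longleftrightarrow> holds H (Qs @ [S']) \<alpha>"
    if "\<alpha> \<in> atoms M (length (terminals H)) (Suc ?j)" for \<alpha>
    using mtype_holds[OF assms(1)] assms(2,3) that by simp
  \<comment> \<open>\<open>?j\<close> is the position of \<open>S\<close> and of \<open>S'\<close>.
    Nonemptiness inside a graph means that \<open>NoEdge\<close> or \<open>NoVert\<close> fails, and
    this transfers.\<close>
  have "S \<inter> edges G \<noteq> {} \<or> S \<inter> verts G \<noteq> {}" using S by (auto simp: inds_def)
  then have "S' \<inter> inds H \<noteq> {}"
    using at[of "NoEdge ?j"] at[of "NoVert ?j"] assms(3)
    by (auto simp: nth_append inds_def)
  then obtain a' where a': "a' \<in> S'" "a' \<in> inds H" by blast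
  \<comment> \<open>The move \<open>{a'}\<close> picks a nonempty subset of \<open>S'\<close>. Its
    answer \<open>Y\<close> meets the graph in a nonempty subset of the singleton, so it contains
    all of it; transferred back, this inclusion says that \<open>{a'}\<close> exhausts
    \<open>S'\<close> inside \<open>H\<close>.\<close>
  obtain Y where Y: "mtype M k H ((Qs @ [S']) @ [{a'}]) = mtype M k G ((Ps @ [S]) @ [Y])"
    using mtype_move[OF assms(1)[symmetric]] by blast
  have at2: "holds H ((Qs @ [S']) @ [{a'}]) \<alpha> \<longleftrightarrow> holds G ((Ps @ [S]) @ [Y]) \<alpha>"
    if "\<alpha> \<in> atoms M (length (terminals H)) (Suc (Suc ?j))" for \<alpha>
    using mtype_holds[OF Y] assms(2,3) that by simp
  have "{a'} \<inter> edges H \<noteq> {} \<or> {a'} \<inter> verts H \<noteq> {}" using a' by (auto simp: inds_def)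
  then have "Y \<inter> inds G \<noteq> {}"
    using at2[of "NoEdge (Suc ?j)"] at2[of "NoVert (Suc ?j)"] assms(3)
    by (auto simp: nth_append inds_def)
  then obtain y where y: "y \<in> Y" "y \<in> inds G" by blast
  have "Y \<inter> inds G \<subseteq> S"
    using at2[of "Subset (Suc ?j) ?j"] assms(3) a' by (auto simp: nth_append)
  then have "y \<in> S \<inter> inds G" using y by blast
  then have "S \<inter> inds G \<subseteq> Y" unfolding S using y by simp
  then have "holds G ((Ps @ [S]) @ [Y]) (Subset ?j (Suc ?j))"
    using assms(3) by (simp add: nth_append)
  then have "holds H ((Qs @ [S']) @ [{a'}]) (Subset ?j (Suc ?j))"
    using at2[of "Subset ?j (Suc ?j)"] by simp
  then have "S' \<inter> inds H \<subseteq> {a'}" by (simp add: nth_append)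
  then show ?thesis using that a' by blast
qed

section \<open>Assignments coded by lists of sets\<close>

fun depth :: "mso \<Rightarrow> nat" where
  "depth (Neg \<phi>) = depth \<phi>"
| "depth (And \<phi> \<psi>) = max (depth \<phi>) (depth \<psi>)"
| "depth (All x \<phi>) = Suc (depth \<phi>)"
| "depth (AllSet X \<phi>) = Suc (depth \<phi>)"
| "depth _ = 0"

fun width :: "mso \<Rightarrow> nat" where
  "width (Conn y xs) = length xs"
| "width (Neg \<phi>) = width \<phi>"
| "width (And \<phi> \<psi>) = max (width \<phi>) (width \<psi>)"
| "width (All x \<phi>) = width \<phi>"
| "width (AllSet X \<phi>) = width \<phi>"
| "width _ = 0"

text \<open>\<open>p\<close> and \<open>q\<close> give the position in \<open>Ps\<close> of the set
  standing for a variable. Only free variables are constrained, so a sentence is coded by the empty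
  list whatever the assignments.\<close>

definition codes ::
  "'a graph \<Rightarrow> (nat \<Rightarrow> 'a) \<Rightarrow> (nat \<Rightarrow> 'a set) \<Rightarrow> mso \<Rightarrow> (nat \<Rightarrow> nat) \<Rightarrow> (nat \<Rightarrow> nat) \<Rightarrow>
    'a set list \<Rightarrow> bool" where
  "codes G i s \<phi> p q Ps \<longleftrightarrow>
     (\<forall>x \<in> free_ind \<phi>. p x < length Ps \<and> Ps ! p x \<inter> inds G = {i x}) \<and>
     (\<forall>X \<in> free_set \<phi>. q X < length Ps \<and> Ps ! q X \<inter> inds G = s X)"

lemma codes_indD:
  assumes "codes G i s \<phi> p q Ps" "x \<in> free_ind \<phi>"
  shows "p x < length Ps" and "Ps ! p x \<inter> inds G = {i x}"
  using assms unfolding codes_def by blast+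

lemma codes_setD:
  assumes "codes G i s \<phi> p q Ps" "X \<in> free_set \<phi>"
  shows "q X < length Ps" and "Ps ! q X \<inter> inds G = s X"
  using assms unfolding codes_def by blast+

text \<open>The new position is a parameter \<open>j\<close> of its own so that the same
  \<open>p(x := j)\<close> serves two graphs whose lists have equal length.\<close>

lemma codes_All:
  assumes c: "codes G i s (All x \<phi>) p q Ps" and S: "S \<inter> inds G = {a}" and j: "j = length Ps"
  shows "codes G (i(x := a)) s \<phi> (p(x := j)) q (Ps @ [S])"
proof -
  have "(p(x := j)) y < length (Ps @ [S]) \<and>
      (Ps @ [S]) ! (p(x := j)) y \<inter> inds G = {(i(x := a)) y}" if "y \<in> free_ind \<phi>" for y
    using S j codes_indD[OF c, of y] that by (cases "y = x") (simp_all add: nth_append)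
  moreover have "q X < length (Ps @ [S]) \<and> (Ps @ [S]) ! q X \<inter> inds G = s X"
    if "X \<in> free_set \<phi>" for X
    using codes_setD[OF c, of X] that by (simp add: nth_append)
  ultimately show ?thesis unfolding codes_def by blast
qed

lemma codes_AllSet:
  assumes c: "codes G i s (AllSet X \<phi>) p q Ps" and S: "S \<inter> inds G = T" and j: "j = length Ps"
  shows "codes G i (s(X := T)) \<phi> p (q(X := j)) (Ps @ [S])"
proof -
  have "p y < length (Ps @ [S]) \<and> (Ps @ [S]) ! p y \<inter> inds G = {i y}"
    if "y \<in> free_ind \<phi>" for y
    using codes_indD[OF c, of y] that by (simp add: nth_append)
  moreover have "(q(X := j)) Y < length (Ps @ [S]) \<and>
      (Ps @ [S]) ! (q(X := j)) Y \<inter> inds G = (s(X := T)) Y" if "Y \<in> free_set \<phi>" for Y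
    using S j codes_setD[OF c, of Y] that by (cases "Y = X") (simp_all add: nth_append)
  ultimately show ?thesis unfolding codes_def by blast
qed

text \<open>Equality and membership of individuals become inclusions of singletons;
  \<open>Conn\<close> becomes \<open>Incid\<close> because each set named in it has one point inside
  the graph, which leaves one possible edge and one possible word. The formula is a variable equated
  with each case so that one hypothesis \<open>codes\<close> covers all five.\<close>

lemma atom_of_literal:
  assumes c: "codes G i s \<phi> p q Ps" and wf: "wf_graph G"
  shows "\<phi> = Vert x \<Longrightarrow> sat G i s \<phi> \<longleftrightarrow> holds G Ps (NoEdge (p x))"
    and "\<phi> = Edge x \<Longrightarrow> sat G i s \<phi> \<longleftrightarrow> holds G Ps (NoVert (p x))"
    and "\<phi> = Eq x y \<Longrightarrow> sat G i s \<phi> \<longleftrightarrow> holds G Ps (Subset (p x) (p y))"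
    and "\<phi> = Mem X x \<Longrightarrow> sat G i s \<phi> \<longleftrightarrow> holds G Ps (Subset (p x) (q X))"
    and "\<phi> = Conn y xs \<Longrightarrow> sat G i s \<phi> \<longleftrightarrow> holds G Ps (Incid (p y) (map p xs))"
proof -
  have disj: "verts G \<inter> edges G = {}" using wf by (simp add: wf_graph_def)
  have ind: "v \<in> Ps ! p x \<longleftrightarrow> v = i x" if "x \<in> free_ind \<phi>" "v \<in> inds G" for x v
    using codes_indD(2)[OF c that(1)] that(2) by (metis Int_iff singleton_iff)
  have ix: "i x \<in> inds G" if "x \<in> free_ind \<phi>" for x
    using codes_indD(2)[OF c that] by (metis Int_iff singletonI)
  have set: "v \<in> Ps ! q X \<longleftrightarrow> v \<in> s X" if "X \<in> free_set \<phi>" "v \<in> inds G" for X v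
    using codes_setD(2)[OF c that(1)] that(2) by (metis Int_iff)
  have inter: "Ps ! p x \<inter> A = {i x} \<inter> A" if "x \<in> free_ind \<phi>" "A \<subseteq> inds G" for x A
    using codes_indD(2)[OF c that(1)] that(2) by (metis inf.absorb_iff2 inf_assoc)
  show "sat G i s \<phi> \<longleftrightarrow> holds G Ps (NoEdge (p x))" if phi: "\<phi> = Vert x"
  proof -
    have x: "x \<in> free_ind \<phi>" using phi by simp
    have "i x \<in> verts G \<longleftrightarrow> i x \<notin> edges G" using ix[OF x] disj by (auto simp: inds_def)
    then show ?thesis using phi inter[OF x, of "edges G"] by (simp add: inds_def)
  qed
  show "sat G i s \<phi> \<longleftrightarrow> holds G Ps (NoVert (p x))" if phi: "\<phi> = Edge x"
  proof -
    have x: "x \<in> free_ind \<phi>" using phi by simp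
    have "i x \<in> edges G \<longleftrightarrow> i x \<notin> verts G" using ix[OF x] disj by (auto simp: inds_def)
    then show ?thesis using phi inter[OF x, of "verts G"] by (simp add: inds_def)
  qed
  show "sat G i s \<phi> \<longleftrightarrow> holds G Ps (Subset (p x) (p y))" if phi: "\<phi> = Eq x y"
  proof -
    have x: "x \<in> free_ind \<phi>" and y: "y \<in> free_ind \<phi>" using phi by simp_all
    show ?thesis using phi codes_indD(2)[OF c x] ind[OF y ix[OF x]] by simp
  qed
  show "sat G i s \<phi> \<longleftrightarrow> holds G Ps (Subset (p x) (q X))" if phi: "\<phi> = Mem X x"
  proof -
    have x: "x \<in> free_ind \<phi>" and X: "X \<in> free_set \<phi>" using phi by simp_all
    show ?thesis using phi codes_indD(2)[OF c x] set[OF X ix[OF x]] by simp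
  qed
  show "sat G i s \<phi> \<longleftrightarrow> holds G Ps (Incid (p y) (map p xs))" if phi: "\<phi> = Conn y xs"
  proof -
    have word: "list_all2 (\<lambda>v x. v \<in> Ps ! x) (ends G e) (map p xs) \<longleftrightarrow> ends G e = map i xs"
      if e: "e \<in> edges G" for e
    proof -
      have sub: "v \<in> inds G" if "v \<in> set (ends G e)" for v
        using wf e that unfolding wf_graph_def inds_def by blast
      have free: "x \<in> free_ind \<phi>" if "x \<in> set xs" for x using phi that by simp
      have "list_all2 (\<lambda>v x. v \<in> Ps ! x) (ends G e) (map p xs) \<longleftrightarrow>
          list_all2 (\<lambda>v x. v \<in> Ps ! p x) (ends G e) xs"
        by (simp add: list.rel_map)
      also have "\<dots> \<longleftrightarrow> list_all2 (\<lambda>v x. v = i x) (ends G e) xs"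
        by (intro list.rel_cong refl) (rule ind[OF free sub])
      also have "\<dots> \<longleftrightarrow> list_all2 (=) (ends G e) (map i xs)"
        by (simp add: list.rel_map)
      finally show ?thesis by (simp add: list.rel_eq)
    qed
    have "y \<in> free_ind \<phi>" using phi by simp
    note y = ind[OF this]
    have "e \<in> Ps ! p y \<longleftrightarrow> e = i y" if "e \<in> edges G" for e
      using y that by (simp add: inds_def)
    then have "holds G Ps (Incid (p y) (map p xs)) \<longleftrightarrow>
        (\<exists>e \<in> edges G. e = i y \<and> ends G e = map i xs)"
      unfolding holds.simps using word by (intro bex_cong refl) simp
    then show ?thesis using phi by auto
  qed
qed

text \<open>The rank must exceed the depth strictly: recognising the answer to an individual move as
  a singleton costs one move more than the quantifier itself.\<close>

lemma mtype_sat: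
  assumes wf: "wf_graph G" "wf_graph H" and n: "length (terminals G) = length (terminals H)"
    and "length Ps = length Qs" "depth \<phi> < k" "width \<phi> \<le> M"
    and "mtype M k G Ps = mtype M k H Qs"
    and "codes G i s \<phi> p q Ps" "codes H i' s' \<phi> p q Qs"
  shows "sat G i s \<phi> \<longleftrightarrow> sat H i' s' \<phi>"
  using assms(4-)
proof (induction \<phi> arbitrary: Ps Qs k i s i' s' p q)
  case (Vert x)
  then show ?case
    using mtype_holds[OF Vert(4) n Vert(1), of "NoEdge (p x)"] atom_of_literal(1) wf
    by (metis atoms_simps(2) codes_def free_ind.simps(1) singletonI)
next
  case (Edge x)
  then show ?case
    using mtype_holds[OF Edge(4) n Edge(1), of "NoVert (p x)"] atom_of_literal(2) wf
    by (metis atoms_simps(3) codes_def free_ind.simps(2) singletonI)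
next
  case (Eq x y)
  have "p x < length Qs" "p y < length Qs" using Eq(6) by (auto simp: codes_def)
  then show ?case
    using mtype_holds[OF Eq(4) n Eq(1), of "Subset (p x) (p y)"]
      atom_of_literal(3)[OF Eq(5) wf(1)] atom_of_literal(3)[OF Eq(6) wf(2)] by simp
next
  case (Mem X x)
  have "p x < length Qs" "q X < length Qs" using Mem(6) by (auto simp: codes_def)
  then show ?case
    using mtype_holds[OF Mem(4) n Mem(1), of "Subset (p x) (q X)"]
      atom_of_literal(4)[OF Mem(5) wf(1)] atom_of_literal(4)[OF Mem(6) wf(2)] by simp
next
  case (Conn y xs)
  have "p y < length Qs" "p ` set xs \<subseteq> {..<length Qs}" using Conn(6) by (auto simp: codes_def)
  moreover have "length xs \<le> M" using Conn(3) by simp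
  ultimately show ?case
    using mtype_holds[OF Conn(4) n Conn(1), of "Incid (p y) (map p xs)"]
      atom_of_literal(5)[OF Conn(5) wf(1)] atom_of_literal(5)[OF Conn(6) wf(2)] by simp
next
  case (Neg \<phi>)
  then have "sat G i s \<phi> \<longleftrightarrow> sat H i' s' \<phi>"
    by (intro Neg.IH[of Ps Qs k]) (auto simp: codes_def)
  then show ?case by simp
next
  case (And \<phi> \<psi>)
  have "sat G i s \<phi> \<longleftrightarrow> sat H i' s' \<phi>"
    using And.prems by (intro And.IH(1)[of Ps Qs k]) (auto simp: codes_def)
  moreover have "sat G i s \<psi> \<longleftrightarrow> sat H i' s' \<psi>"
    using And.prems by (intro And.IH(2)[of Ps Qs k]) (auto simp: codes_def)
  ultimately show ?case by simp
next
  case (All x \<phi>)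
  \<comment> \<open>One rank is spent on the quantifier, and the remaining \<open>Suc k'\<close> is
    of the form that \<open>mtype_singleton\<close> asks for.\<close>
  obtain k' where k: "k = Suc (Suc k')" "depth \<phi> < Suc k'"
    using less_imp_Suc_add[OF All.prems(2)] by fastforce
  have disj: "verts G \<inter> edges G = {}" "verts H \<inter> edges H = {}"
    using wf by (auto simp: wf_graph_def)
  have w: "width \<phi> \<le> M" using All.prems(3) by simp
  have step: "sat G (i(x := a)) s \<phi> \<longleftrightarrow> sat H (i'(x := a')) s' \<phi>"
    if "mtype M (Suc k') G (Ps @ [S]) = mtype M (Suc k') H (Qs @ [S'])"
      "S \<inter> inds G = {a}" "S' \<inter> inds H = {a'}" for S S' a a'
    by (rule All.IH[OF _ k(2) w that(1) codes_All[OF All.prems(5) that(2) refl]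
          codes_All[OF All.prems(6) that(3)]]) (simp_all add: All.prems(1))
  have "sat H (i'(x := a')) s' \<phi>" if L: "\<forall>a \<in> inds G. sat G (i(x := a)) s \<phi>" and a': "a' \<in> inds H" for a'
  proof -
    obtain S where S: "mtype M (Suc k') H (Qs @ [{a'}]) = mtype M (Suc k') G (Ps @ [S])"
      using mtype_move[OF All.prems(4)[unfolded k(1), symmetric]] .
    obtain a where a: "a \<in> inds G" "S \<inter> inds G = {a}"
      using mtype_singleton[OF S n[symmetric] All.prems(1)[symmetric] disj(2,1), of a'] a' by auto
    show ?thesis using step[OF S[symmetric] a(2)] a' L a(1) by blast
  qed
  moreover have "sat G (i(x := a)) s \<phi>" if L: "\<forall>a' \<in> inds H. sat H (i'(x := a')) s' \<phi>" and a: "a \<in> inds G" for a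
  proof -
    obtain S' where S: "mtype M (Suc k') G (Ps @ [{a}]) = mtype M (Suc k') H (Qs @ [S'])"
      using mtype_move[OF All.prems(4)[unfolded k(1)]] .
    obtain a' where a': "a' \<in> inds H" "S' \<inter> inds H = {a'}"
      using mtype_singleton[OF S n All.prems(1) disj, of a] a by auto
    show ?thesis using step[OF S _ a'(2)] a L a'(1) by blast
  qed
  ultimately show ?case by auto
next
  case (AllSet X \<phi>)
  obtain k' where k: "k = Suc k'" "depth \<phi> < k'"
    using less_imp_Suc_add[OF AllSet.prems(2)] by fastforce
  have w: "width \<phi> \<le> M" using AllSet.prems(3) by simp
  have disj: "verts G \<inter> edges G = {}" "verts H \<inter> edges H = {}"
    using wf by (auto simp: wf_graph_def)
  \<comment> \<open>Set variables exclude mixed sets while moves are arbitrary, so the answer to an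
    admissible set must be shown admissible; \<open>NoEdge\<close> and \<open>NoVert\<close> see
    this.\<close>
  have vesets: "T \<inter> inds K \<in> vesets K \<longleftrightarrow> T \<inter> edges K = {} \<or> T \<inter> verts K = {}"
    if "verts K \<inter> edges K = {}" for K :: "'x graph" and T
    using that by (auto simp: vesets_def inds_def)
  have step: "sat G i (s(X := S \<inter> inds G)) \<phi> \<longleftrightarrow> sat H i' (s'(X := S' \<inter> inds H)) \<phi>"
    and ves: "S \<inter> inds G \<in> vesets G \<longleftrightarrow> S' \<inter> inds H \<in> vesets H"
    if eq: "mtype M k' G (Ps @ [S]) = mtype M k' H (Qs @ [S'])" for S S'
  proof -
    show "sat G i (s(X := S \<inter> inds G)) \<phi> \<longleftrightarrow> sat H i' (s'(X := S' \<inter> inds H)) \<phi>"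
      by (rule AllSet.IH[OF _ k(2) w eq codes_AllSet[OF AllSet.prems(5) refl refl]
            codes_AllSet[OF AllSet.prems(6) refl]]) (simp_all add: AllSet.prems(1))
    have "S \<inter> edges G = {} \<longleftrightarrow> S' \<inter> edges H = {}" "S \<inter> verts G = {} \<longleftrightarrow> S' \<inter> verts H = {}"
      using mtype_holds[OF eq n, of "NoEdge (length Qs)"]
        mtype_holds[OF eq n, of "NoVert (length Qs)"] AllSet.prems(1)
      by (simp_all add: nth_append)
    then show "S \<inter> inds G \<in> vesets G \<longleftrightarrow> S' \<inter> inds H \<in> vesets H"
      using vesets[OF disj(1), of S] vesets[OF disj(2), of S'] by simp
  qed
  have interG: "S \<inter> inds G = S" if "S \<in> vesets G" for S
    using that by (auto simp: vesets_def inds_def)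
  have interH: "S \<inter> inds H = S" if "S \<in> vesets H" for S
    using that by (auto simp: vesets_def inds_def)
  have "sat H i' (s'(X := S')) \<phi>" if L: "\<forall>S \<in> vesets G. sat G i (s(X := S)) \<phi>" and S': "S' \<in> vesets H" for S'
  proof -
    obtain S where "mtype M k' H (Qs @ [S']) = mtype M k' G (Ps @ [S])"
      using mtype_move[OF AllSet.prems(4)[unfolded k(1), symmetric]] .
    from step[OF this[symmetric]] ves[OF this[symmetric]] show ?thesis
      using L S' interH[OF S'] by simp
  qed
  moreover have "sat G i (s(X := S)) \<phi>" if L: "\<forall>S' \<in> vesets H. sat H i' (s'(X := S')) \<phi>" and S: "S \<in> vesets G" for S
  proof -
    obtain S' where "mtype M k' G (Ps @ [S]) = mtype M k' H (Qs @ [S'])"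
      using mtype_move[OF AllSet.prems(4)[unfolded k(1)]] .
    from step[OF this] ves[OF this] show ?thesis
      using L S interG[OF S] by simp
  qed
  ultimately show ?case by auto
qed

section \<open>Types and graph operations\<close>

text \<open>
  The map \<open>h\<close> presents \<open>G'\<close> as the quotient of \<open>G\<close> that identifies the pairs of terminals listed
  in \<open>K\<close>, followed by redefinition of terminals along \<open>\<sigma>\<close>.  Isomorphisms are the case
  where \<open>K\<close> is empty and \<open>\<sigma>\<close> is the identity.
\<close>
definition quotient_map ::
  "('a \<Rightarrow> 'b) \<Rightarrow> (nat \<times> nat) set \<Rightarrow> nat list \<Rightarrow> 'a graph \<Rightarrow> 'b graph \<Rightarrow> bool" where
  "quotient_map h K \<sigma> G G' \<longleftrightarrow>
     set (terminals G) \<subseteq> verts G \<and> (\<forall>e \<in> edges G. set (ends G e) \<subseteq> verts G) \<and>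
     K \<subseteq> {..<length (terminals G)} \<times> {..<length (terminals G)} \<and>
     set \<sigma> \<subseteq> {..<length (terminals G)} \<and>
     verts G' = h ` verts G \<and> edges G' = h ` edges G \<and>
     (\<forall>e \<in> edges G. ends G' (h e) = map h (ends G e)) \<and>
     terminals G' = map (\<lambda>a. h (terminals G ! a)) \<sigma> \<and>
     (\<forall>x \<in> inds G. \<forall>y \<in> inds G. h x = h y \<longleftrightarrow>
        x = y \<or> (\<exists>(a, b) \<in> K. x = terminals G ! a \<and> y = terminals G ! b))"

section \<open>Sets and atoms along a quotient map\<close>

definition pulled :: "('a \<Rightarrow> 'b) \<Rightarrow> 'a graph \<Rightarrow> 'a set list \<Rightarrow> 'b set list \<Rightarrow> bool" where
  "pulled h G Ps Ps' \<longleftrightarrow> list_all2 (\<lambda>P P'. \<forall>x \<in> inds G. x \<in> P \<longleftrightarrow> h x \<in> P') Ps Ps'"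

lemma pulled_snoc:
  "pulled h G Ps Ps' \<Longrightarrow> (\<And>x. x \<in> inds G \<Longrightarrow> x \<in> S \<longleftrightarrow> h x \<in> S') \<Longrightarrow>
    pulled h G (Ps @ [S]) (Ps' @ [S'])"
  by (auto simp: pulled_def intro: list_all2_appendI)

fun pull_atom :: "nat list \<Rightarrow> atom \<Rightarrow> atom" where
  "pull_atom \<sigma> (TermIn a i) = TermIn (\<sigma> ! a) i"
| "pull_atom \<sigma> \<alpha> = \<alpha>"

lemma quotient_mapD:
  assumes "quotient_map h K \<sigma> G G'"
  shows "terminals G' = map (\<lambda>a. h (terminals G ! a)) \<sigma>"
    and "verts G' = h ` verts G" "edges G' = h ` edges G" "inds G' = h ` inds G"
    and "e \<in> edges G \<Longrightarrow> ends G' (h e) = map h (ends G e)"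
    and "e \<in> edges G \<Longrightarrow> set (ends G e) \<subseteq> inds G"
    and "a < length (terminals G) \<Longrightarrow> terminals G ! a \<in> inds G"
    and "b < length \<sigma> \<Longrightarrow> \<sigma> ! b < length (terminals G)"
    and "(a, b) \<in> K \<Longrightarrow> a < length (terminals G) \<and> b < length (terminals G)"
    and "x \<in> inds G \<Longrightarrow> y \<in> inds G \<Longrightarrow> h x = h y \<longleftrightarrow>
      x = y \<or> (\<exists>(a, b) \<in> K. x = terminals G ! a \<and> y = terminals G ! b)"
proof -
  note q = assms[unfolded quotient_map_def]
  show "terminals G' = map (\<lambda>a. h (terminals G ! a)) \<sigma>"
    and V: "verts G' = h ` verts G" and E: "edges G' = h ` edges G"
    using q by blast+
  then show "inds G' = h ` inds G" by (simp add: inds_def image_Un)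
  show "ends G' (h e) = map h (ends G e)" if "e \<in> edges G"
    using q that by blast
  show "set (ends G e) \<subseteq> inds G" if "e \<in> edges G"
    using q that unfolding inds_def by blast
  have "set (terminals G) \<subseteq> verts G" using q by (elim conjE)
  then show "terminals G ! a \<in> inds G" if "a < length (terminals G)"
    using nth_mem[OF that] unfolding inds_def by blast
  have "set \<sigma> \<subseteq> {..<length (terminals G)}" using q by (elim conjE)
  then show "\<sigma> ! b < length (terminals G)" if "b < length \<sigma>"
    using nth_mem[OF that] by blast
  have "K \<subseteq> {..<length (terminals G)} \<times> {..<length (terminals G)}" using q by (elim conjE)
  then show "a < length (terminals G) \<and> b < length (terminals G)" if "(a, b) \<in> K"
    using that by blast
  show "h x = h y \<longleftrightarrow> x = y \<or> (\<exists>(a, b) \<in> K. x = terminals G ! a \<and> y = terminals G ! b)"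
    if "x \<in> inds G" "y \<in> inds G"
    using q that by blast
qed

text \<open>\<open>h\<close> is onto vertices and edges and carries words to words, so each atom can
  be checked on preimages. A terminal of the quotient is the image of the one that \<sigma> selects,
  hence \<open>pull_atom\<close>. A singleton atom would fail here, since a fused vertex can have
  two preimages.\<close>

lemma holds_quotient:
  assumes q: "quotient_map h K \<sigma> G G'" and P: "pulled h G Ps Ps'"
    and \<alpha>: "\<alpha> \<in> atoms M (length \<sigma>) (length Ps')"
  shows "holds G' Ps' \<alpha> \<longleftrightarrow> holds G Ps (pull_atom \<sigma> \<alpha>)"
proof -
  have mem: "x \<in> Ps ! i \<longleftrightarrow> h x \<in> Ps' ! i" if "x \<in> inds G" "i < length Ps'" for x i
    using P that unfolding pulled_def list_all2_conv_all_nth by simp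
  have disjoint: "Ps' ! i \<inter> h ` A = {} \<longleftrightarrow> Ps ! i \<inter> A = {}"
    if "A \<subseteq> inds G" "i < length Ps'" for A i
    using mem[OF _ that(2)] that(1) by blast
  show ?thesis
  proof (cases \<alpha>)
    case (Subset i j)
    then have "i < length Ps'" "j < length Ps'" using \<alpha> by simp_all
    then have "Ps' ! i \<inter> h ` inds G \<subseteq> Ps' ! j \<longleftrightarrow> Ps ! i \<inter> inds G \<subseteq> Ps ! j"
      using mem by blast
    then show ?thesis using Subset by (simp add: quotient_mapD(4)[OF q])
  next
    case (NoEdge i)
    then show ?thesis
      using \<alpha> disjoint[of "edges G" i] by (simp add: quotient_mapD(3)[OF q] inds_def)
  next
    case (NoVert i)
    then show ?thesis
      using \<alpha> disjoint[of "verts G" i] by (simp add: quotient_mapD(2)[OF q] inds_def)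
  next
    case (TermIn a i)
    then have a: "a < length \<sigma>" "i < length Ps'" using \<alpha> by simp_all
    then show ?thesis
      using TermIn mem[OF quotient_mapD(7)[OF q quotient_mapD(8)[OF q a(1)]] a(2)]
      by (simp add: quotient_mapD(1)[OF q])
  next
    case (Incid y xs)
    then have xs: "x < length Ps'" if "x \<in> set xs" for x
      using \<alpha> that by auto
    have y: "y < length Ps'" using \<alpha> Incid by simp
    have word: "list_all2 (\<lambda>v x. v \<in> Ps' ! x) (ends G' (h e)) xs \<longleftrightarrow>
        list_all2 (\<lambda>v x. v \<in> Ps ! x) (ends G e) xs" if e: "e \<in> edges G" for e
    proof -
      have "list_all2 (\<lambda>v x. h v \<in> Ps' ! x) (ends G e) xs \<longleftrightarrow>
        list_all2 (\<lambda>v x. v \<in> Ps ! x) (ends G e) xs"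
        by (intro list.rel_cong refl mem[symmetric] xs)
          (use quotient_mapD(6)[OF q e] in blast)+
      then show ?thesis by (simp add: quotient_mapD(5)[OF q e] list.rel_map)
    qed
    have "e \<in> Ps ! y \<longleftrightarrow> h e \<in> Ps' ! y" if "e \<in> edges G" for e
      using mem[OF _ y] that by (simp add: inds_def)
    then have "(\<exists>e \<in> edges G. h e \<in> Ps' ! y \<and> list_all2 (\<lambda>v x. v \<in> Ps' ! x) (ends G' (h e)) xs)
        \<longleftrightarrow> holds G Ps (Incid y xs)"
      unfolding holds.simps using word by (intro bex_cong refl) simp
    then show ?thesis using Incid by (simp add: quotient_mapD(3)[OF q])
  qed
qed

text \<open>A move in one quotient is pulled back, answered in the other graph, and the answer is
  pushed forward. The answer cannot separate identified vertices, because membership of terminals is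
  an atom.\<close>

lemma mtype_quotient:
  assumes q: "quotient_map h K \<sigma> G G'" "quotient_map f K \<sigma> H H'"
    and n: "length (terminals G) = length (terminals H)"
    and "length Ps = length Qs" "pulled h G Ps Ps'" "pulled f H Qs Qs'"
    and "mtype M k G Ps = mtype M k H Qs"
  shows "mtype M k G' Ps' = mtype M k H' Qs'"
  using assms(4-)
proof (induction k arbitrary: Ps Qs Ps' Qs')
  case 0
  have len: "length Ps' = length Ps" "length Qs' = length Qs"
    using 0(2,3)[unfolded pulled_def, THEN list_all2_lengthD] by simp_all
  have t: "length (terminals G') = length \<sigma>" "length (terminals H') = length \<sigma>"
    by (simp_all add: quotient_mapD(1)[OF q(1)] quotient_mapD(1)[OF q(2)])
  show ?case
  proof (rule mtype_0_eqI)
    fix \<alpha> assume \<alpha>: "\<alpha> \<in> atoms M (length (terminals H')) (length Qs')"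
    have "pull_atom \<sigma> \<alpha> \<in> atoms M (length (terminals H)) (length Qs)"
      using \<alpha> t len quotient_mapD(8)[OF q(2)] by (cases \<alpha>) simp_all
    then have "holds G Ps (pull_atom \<sigma> \<alpha>) \<longleftrightarrow> holds H Qs (pull_atom \<sigma> \<alpha>)"
      using mtype_holds[OF 0(4) n 0(1)] by blast
    then show "holds G' Ps' \<alpha> \<longleftrightarrow> holds H' Qs' \<alpha>"
      using holds_quotient[OF q(1) 0(2), of \<alpha> M] holds_quotient[OF q(2) 0(3), of \<alpha> M] \<alpha> t len 0(1)
      by simp
  qed (use t len 0(1) in simp_all)
next
  case (Suc k)
  \<comment> \<open>Stated for arbitrary graphs, with the induction hypothesis as an assumption, so
    that it serves in both directions with the roles of \<open>G\<close> and \<open>H\<close>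
    exchanged.\<close>
  have respond: "\<exists>S'. mtype M k G1' (Ps1' @ [T]) = mtype M k G2' (Ps2' @ [S'])"
    if q: "quotient_map h1 K \<sigma> G1 G1'" "quotient_map h2 K \<sigma> G2 G2'"
    and n: "length (terminals G1) = length (terminals G2)" "length Ps1 = length Ps2"
    and P: "pulled h1 G1 Ps1 Ps1'" "pulled h2 G2 Ps2 Ps2'"
    and eq: "mtype M (Suc k) G1 Ps1 = mtype M (Suc k) G2 Ps2"
    and IH: "\<And>S S' T'. pulled h1 G1 (Ps1 @ [S]) (Ps1' @ [T]) \<Longrightarrow>
       pulled h2 G2 (Ps2 @ [S']) (Ps2' @ [T']) \<Longrightarrow>
       mtype M k G1 (Ps1 @ [S]) = mtype M k G2 (Ps2 @ [S']) \<Longrightarrow>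
       mtype M k G1' (Ps1' @ [T]) = mtype M k G2' (Ps2' @ [T'])"
    for h1 :: "'x \<Rightarrow> 'y" and h2 :: "'z \<Rightarrow> 'w" and G1 G1' G2 G2' Ps1 Ps1' Ps2 Ps2' T
  proof -
    obtain S' where S': "mtype M k G1 (Ps1 @ [h1 -` T]) = mtype M k G2 (Ps2 @ [S'])"
      using mtype_move[OF eq] .
    \<comment> \<open>The preimage of \<open>T\<close> contains both or neither of two identified
      terminals of \<open>G1\<close>; \<open>TermIn\<close> hands this on to
      \<open>S'\<close>.\<close>
    have saturated: "terminals G2 ! a \<in> S' \<longleftrightarrow> terminals G2 ! b \<in> S'" if K: "(a, b) \<in> K" for a b
    proof -
      have ab: "a < length (terminals G1)" "b < length (terminals G1)"
        using quotient_mapD(9)[OF q(1) K] by simp_all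
      have "h1 (terminals G1 ! a) = h1 (terminals G1 ! b)"
        using quotient_mapD(10)[OF q(1) ab[THEN quotient_mapD(7)[OF q(1)]]] K by blast
      then show ?thesis
        using mtype_holds[OF S' n(1), of "TermIn a (length Ps2)"]
          mtype_holds[OF S' n(1), of "TermIn b (length Ps2)"] ab n by (simp add: nth_append)
    qed
    \<comment> \<open>Saturation makes \<open>S'\<close> the preimage of its image, inside
      \<open>G2\<close>.\<close>
    have resp: "x \<in> S' \<longleftrightarrow> h2 x \<in> h2 ` (S' \<inter> inds G2)" if x: "x \<in> inds G2" for x
    proof
      assume "h2 x \<in> h2 ` (S' \<inter> inds G2)"
      then obtain y where y: "y \<in> S'" "y \<in> inds G2" "h2 x = h2 y" by blast
      then consider "x = y" | a b where "(a, b) \<in> K" "x = terminals G2 ! a" "y = terminals G2 ! b"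
        using quotient_mapD(10)[OF q(2) x y(2)] by blast
      then show "x \<in> S'" using y(1) saturated by cases simp_all
    qed (use x in blast)
    have "mtype M k G1' (Ps1' @ [T]) = mtype M k G2' (Ps2' @ [h2 ` (S' \<inter> inds G2)])"
      by (rule IH[OF pulled_snoc[OF P(1)] pulled_snoc[OF P(2)] S']) (simp_all add: resp)
    then show ?thesis ..
  qed
  have "\<exists>S'. mtype M k G' (Ps' @ [T]) = mtype M k H' (Qs' @ [S'])" for T
    by (rule respond[OF q n Suc.prems], rule Suc.IH) (simp_all add: Suc.prems(1))
  moreover have "\<exists>S'. mtype M k H' (Qs' @ [T]) = mtype M k G' (Ps' @ [S'])" for T
    by (rule respond[OF q(2,1) n[symmetric] Suc.prems(1)[symmetric] Suc.prems(3,2)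
          Suc.prems(4)[symmetric]], rule sym, rule Suc.IH)
      (auto simp: Suc.prems(1) intro: sym)
  ultimately show ?case by (rule mtype_Suc_eqI)
qed



section \<open>Isomorphism, redefinition of terminals and fusion\<close>

lemma mtype_iso:
  assumes "graph_iso G H"
  shows "mtype M k G [] = mtype M k H []"
proof -
  obtain f g where fg: "is_iso f g G H" and wf: "wf_graph G" "wf_graph H"
    using assms by (auto simp: graph_iso_def)
  \<comment> \<open>Vertices and edges are disjoint, so the two bijections glue to one map on
    individuals.\<close>
  define h where "h x = (if x \<in> verts G then f x else g x)" for x
  have hV: "h x = f x" if "x \<in> verts G" for x using that by (simp add: h_def)
  have hE: "h e = g e" if "e \<in> edges G" for e
    using that wf(1) by (auto simp: h_def wf_graph_def)
  have V: "verts H = h ` verts G" and E: "edges H = h ` edges G"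
    using fg hV hE by (simp_all add: is_iso_def bij_betw_def)
  have "inj_on h (verts G)" "inj_on h (edges G)"
    using fg hV hE by (simp_all add: is_iso_def bij_betw_def cong: inj_on_cong)
  moreover have "h ` verts G \<inter> h ` edges G = {}"
    using wf(2) by (simp add: wf_graph_def V[symmetric] E[symmetric])
  ultimately have inj: "inj_on h (inds G)" unfolding inds_def inj_on_Un by blast
  have hmap: "map h vs = map f vs" if "set vs \<subseteq> verts G" for vs
    using that hV by (intro map_cong) auto
  have tG: "set (terminals G) \<subseteq> verts G" using wf(1) by (simp add: wf_graph_def)
  have eG: "set (ends G e) \<subseteq> verts G" if "e \<in> edges G" for e
    using wf(1) that by (simp add: wf_graph_def)
  have nth: "map (\<lambda>a. h' (ts ! a)) [0..<length ts] = map h' ts"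
    for h' :: "'a \<Rightarrow> 'c" and ts
    by (rule nth_equalityI) simp_all
  \<comment> \<open>Both \<open>G\<close> and \<open>H\<close> are presented as quotients of
    \<open>G\<close> with nothing identified; \<open>mtype_quotient\<close> then compares them
    starting from the trivial equality for \<open>G\<close> itself.\<close>
  have "quotient_map id {} [0..<length (terminals G)] G G"
    unfolding quotient_map_def using tG eG nth[of id] by (simp add: lessThan_atLeast0)
  moreover have "quotient_map h {} [0..<length (terminals G)] G H"
    unfolding quotient_map_def
  proof (intro conjI ballI)
    show "ends H (h e) = map h (ends G e)" if "e \<in> edges G" for e
      using fg that by (simp add: is_iso_def hE hmap eG)
    show "terminals H = map (\<lambda>a. h (terminals G ! a)) [0..<length (terminals G)]"
      using fg unfolding nth by (simp add: is_iso_def hmap tG)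
    show "h x = h y \<longleftrightarrow> x = y \<or> (\<exists>(a, b) \<in> {}. x = terminals G ! a \<and> y = terminals G ! b)"
      if "x \<in> inds G" "y \<in> inds G" for x y
      using inj_on_eq_iff[OF inj that] by simp
  qed (use tG eG V E in \<open>simp_all add: lessThan_atLeast0\<close>)
  ultimately show ?thesis
    by (rule mtype_quotient[where Ps = "[]" and Qs = "[]"]) (simp_all add: pulled_def)
qed

lemma mtype_redef:
  assumes "wf_graph G" "wf_graph H" "length (terminals G) = length (terminals H)"
    and "set \<sigma> \<subseteq> {..<length (terminals G)}" "mtype M k G [] = mtype M k H []"
  shows "mtype M k (redef_pregraph \<sigma> G) [] = mtype M k (redef_pregraph \<sigma> H) []"
proof -
  have "quotient_map id {} \<sigma> K (redef_pregraph \<sigma> K)"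
    if "wf_graph K" "set \<sigma> \<subseteq> {..<length (terminals K)}" for K :: "'x graph"
    using that by (simp add: quotient_map_def redef_pregraph_def wf_graph_def)
  note q = this
  show ?thesis
    by (rule mtype_quotient[OF q q, where Ps = "[]" and Qs = "[]"])
      (use assms in \<open>simp_all add: pulled_def\<close>)
qed

lemma mtype_fuse:
  assumes "wf_graph G" "wf_graph H" "length (terminals G) = length (terminals H)"
    and "a < length (terminals G)" "b < length (terminals G)" "mtype M k G [] = mtype M k H []"
  shows "mtype M k (fuse_pregraph a b G) [] = mtype M k (fuse_pregraph a b H) []"
proof -
  have *: "\<exists>r. quotient_map r {(a, b), (b, a)} [0..<length (terminals K)] K (fuse_pregraph a b K)"
    if wf: "wf_graph K" and ab: "a < length (terminals K)" "b < length (terminals K)"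
    for K :: "'x graph"
  proof -
    define r where "r = (\<lambda>x. if x = terminals K ! b then terminals K ! a else x)"
    have F: "fuse_pregraph a b K = \<lparr> verts = r ` verts K, edges = edges K,
        ends = (\<lambda>e. map r (ends K e)), terminals = map r (terminals K) \<rparr>"
      unfolding fuse_pregraph_def r_def Let_def using ab by simp
    \<comment> \<open>Only a vertex can be moved by \<open>r\<close>, and names of vertices and
      edges are disjoint.\<close>
    have "r e = e" if "e \<in> edges K" for e
      using that wf ab(2) terminal_in_verts[OF wf ab(2)] unfolding r_def wf_graph_def by auto
    then have "r ` edges K = edges K" "\<forall>e \<in> edges K. r e = e" by simp_all
    moreover have "map (\<lambda>a. r (terminals K ! a)) [0..<length (terminals K)] = map r (terminals K)"
      by (rule nth_equalityI) simp_all
    \<comment> \<open>The kernel is symmetric, so both orders of the pair are listed.\<close>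
    moreover have "r x = r y \<longleftrightarrow> x = y \<or>
        (\<exists>(a, b) \<in> {(a, b), (b, a)}. x = terminals K ! a \<and> y = terminals K ! b)" for x y
      unfolding r_def by auto
    ultimately have "quotient_map r {(a, b), (b, a)} [0..<length (terminals K)] K (fuse_pregraph a b K)"
      unfolding quotient_map_def F using wf ab by (simp add: wf_graph_def lessThan_atLeast0)
    then show ?thesis by (intro exI)
  qed
  obtain r r' where
    "quotient_map r {(a, b), (b, a)} [0..<length (terminals G)] G (fuse_pregraph a b G)"
    "quotient_map r' {(a, b), (b, a)} [0..<length (terminals G)] H (fuse_pregraph a b H)"
    using *[OF assms(1)] *[OF assms(2)] assms(3-5) by auto
  then show ?thesis
    by (rule mtype_quotient[where Ps = "[]" and Qs = "[]"])
      (use assms in \<open>simp_all add: pulled_def\<close>)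
qed

section \<open>Disjoint sums\<close>

definition lpart :: "nat set \<Rightarrow> nat set" where "lpart P = {x. 2 * x \<in> P}"

definition rpart :: "nat set \<Rightarrow> nat set" where "rpart P = {x. 2 * x + 1 \<in> P}"

text \<open>\<open>sum_pregraph\<close> names the first graph by even and the second by odd numbers.
  \<open>lpart\<close> and \<open>rpart\<close> recover the two halves of a set, and
  \<open>join\<close> reassembles them.\<close>

definition join :: "nat set \<Rightarrow> nat set \<Rightarrow> nat set" where
  "join A B = (\<lambda>x. 2 * x) ` A \<union> (\<lambda>x. 2 * x + 1) ` B"

lemma lpart_join [simp]: "lpart (join A B) = A"
  unfolding lpart_def join_def by (auto, presburger)

lemma rpart_join [simp]: "rpart (join A B) = B"
  unfolding rpart_def join_def by (auto, presburger)

lemma join_Int_subset: "P \<inter> join A B \<subseteq> Q \<longleftrightarrow> lpart P \<inter> A \<subseteq> lpart Q \<and> rpart P \<inter> B \<subseteq> rpart Q"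
  by (auto simp: lpart_def rpart_def join_def)

lemma join_Int_empty: "P \<inter> join A B = {} \<longleftrightarrow> lpart P \<inter> A = {} \<and> rpart P \<inter> B = {}"
  by (auto simp: lpart_def rpart_def join_def)

lemma bex_join: "(\<exists>e \<in> join A B. Q e) \<longleftrightarrow> (\<exists>e \<in> A. Q (2 * e)) \<or> (\<exists>e \<in> B. Q (2 * e + 1))"
  by (auto simp: join_def)

lemma sum_pregraph_simps:
  "verts (sum_pregraph G H) = join (verts G) (verts H)"
  "edges (sum_pregraph G H) = join (edges G) (edges H)"
  "inds (sum_pregraph G H) = join (inds G) (inds H)"
  "ends (sum_pregraph G H) (2 * e) = map (\<lambda>x. 2 * x) (ends G e)"
  "ends (sum_pregraph G H) (2 * e + 1) = map (\<lambda>x. 2 * x + 1) (ends H e)"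
  "terminals (sum_pregraph G H) =
     map (\<lambda>x. 2 * x) (terminals G) @ map (\<lambda>x. 2 * x + 1) (terminals H)"
  by (auto simp: sum_pregraph_def Let_def join_def inds_def)

text \<open>An edge of the sum, with its end points, lies in one summand, whence the disjunction for
  \<open>Incid\<close>; inclusion and disjointness are checked in both summands, and the index of a
  terminal tells which summand it belongs to.\<close>

lemma holds_sum:
  assumes \<alpha>: "\<alpha> \<in> atoms M (length (terminals G) + length (terminals H)) (length Ps)"
  shows "holds (sum_pregraph G H) Ps \<alpha> \<longleftrightarrow>
    (case \<alpha> of
       TermIn a i \<Rightarrow>
         if a < length (terminals G) then holds G (map lpart Ps) \<alpha>
         else holds H (map rpart Ps) (TermIn (a - length (terminals G)) i)
     | Incid y xs \<Rightarrow> holds G (map lpart Ps) \<alpha> \<or> holds H (map rpart Ps) \<alpha>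
     | _ \<Rightarrow> holds G (map lpart Ps) \<alpha> \<and> holds H (map rpart Ps) \<alpha>)"
proof (cases \<alpha>)
  case (Subset i j)
  then show ?thesis using \<alpha> by (simp add: sum_pregraph_simps join_Int_subset)
next
  case (NoEdge i)
  then show ?thesis using \<alpha> by (simp add: sum_pregraph_simps join_Int_empty)
next
  case (NoVert i)
  then show ?thesis using \<alpha> by (simp add: sum_pregraph_simps join_Int_empty)
next
  case (TermIn a i)
  then have "i < length Ps" "\<not> a < length (terminals G) \<Longrightarrow> a - length (terminals G) < length (terminals H)"
    using \<alpha> by auto
  then show ?thesis
    using TermIn by (simp add: sum_pregraph_simps nth_append lpart_def rpart_def)
next
  case (Incid y xs)
  then have xs: "x < length Ps" if "x \<in> set xs" for x
    using that \<alpha> by auto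
  have y: "y < length Ps" using Incid \<alpha> by simp
  have "list_all2 (\<lambda>v x. v \<in> Ps ! x) (map (\<lambda>x. 2 * x) vs) xs \<longleftrightarrow>
      list_all2 (\<lambda>v x. v \<in> map lpart Ps ! x) vs xs" for vs
    unfolding list.rel_map using xs by (intro list.rel_cong refl) (simp add: lpart_def)
  moreover have "list_all2 (\<lambda>v x. v \<in> Ps ! x) (map (\<lambda>x. 2 * x + 1) vs) xs \<longleftrightarrow>
      list_all2 (\<lambda>v x. v \<in> map rpart Ps ! x) vs xs" for vs
    unfolding list.rel_map using xs by (intro list.rel_cong refl) (simp add: rpart_def)
  moreover have "2 * e \<in> Ps ! y \<longleftrightarrow> e \<in> map lpart Ps ! y"
    "2 * e + 1 \<in> Ps ! y \<longleftrightarrow> e \<in> map rpart Ps ! y" for e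
    using y by (simp_all add: lpart_def rpart_def)
  ultimately show ?thesis
    unfolding Incid atom.case holds.simps sum_pregraph_simps bex_join by simp
qed

text \<open>A composition argument in the manner of Feferman and Vaught: a move is split into its
  two halves, each is answered in its own summand, and the answers are joined.\<close>

lemma mtype_sum:
  assumes "length (terminals G) = length (terminals G')" "length (terminals H) = length (terminals H')"
    and "length Ps = length Ps'"
    and "mtype M k G (map lpart Ps) = mtype M k G' (map lpart Ps')"
    and "mtype M k H (map rpart Ps) = mtype M k H' (map rpart Ps')"
  shows "mtype M k (sum_pregraph G H) Ps = mtype M k (sum_pregraph G' H') Ps'"
  using assms
proof (induction k arbitrary: G G' H H' Ps Ps')
  case 0
  show ?case
  proof (rule mtype_0_eqI)
    fix \<alpha> assume "\<alpha> \<in> atoms M (length (terminals (sum_pregraph G' H'))) (length Ps')"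
    then have \<alpha>: "\<alpha> \<in> atoms M (length (terminals G') + length (terminals H')) (length Ps')"
      by (simp add: sum_pregraph_simps)
    have G: "holds G (map lpart Ps) \<beta> \<longleftrightarrow> holds G' (map lpart Ps') \<beta>"
      if "\<beta> \<in> atoms M (length (terminals G')) (length Ps')" for \<beta>
      using mtype_holds[OF 0(4,1)] 0(3) that by simp
    have H: "holds H (map rpart Ps) \<beta> \<longleftrightarrow> holds H' (map rpart Ps') \<beta>"
      if "\<beta> \<in> atoms M (length (terminals H')) (length Ps')" for \<beta>
      using mtype_holds[OF 0(5,2)] 0(3) that by simp
    have \<alpha>': "\<alpha> \<in> atoms M (length (terminals G) + length (terminals H)) (length Ps)"
      using \<alpha> 0(1-3) by simp
    show "holds (sum_pregraph G H) Ps \<alpha> \<longleftrightarrow> holds (sum_pregraph G' H') Ps' \<alpha>"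
    proof (cases \<alpha>)
      case (TermIn a i)
      have "\<not> a < length (terminals G') \<Longrightarrow> a - length (terminals G') < length (terminals H')"
        "i < length Ps'" using \<alpha> TermIn by auto
      then show ?thesis
        unfolding holds_sum[OF \<alpha>'] holds_sum[OF \<alpha>]
        using TermIn G[of \<alpha>] H[of "TermIn (a - length (terminals G')) i"] 0(1)
        by (simp del: holds.simps)
    qed (unfold holds_sum[OF \<alpha>'] holds_sum[OF \<alpha>],
        use \<alpha> G[of \<alpha>] H[of \<alpha>] in \<open>simp_all del: holds.simps\<close>)
  qed (use 0 in \<open>simp_all add: sum_pregraph_simps\<close>)
next
  case (Suc k)
  have respond: "\<exists>S'. mtype M k (sum_pregraph G1 H1) (Ps1 @ [S]) =
      mtype M k (sum_pregraph G2 H2) (Ps2 @ [S'])"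
    if "length (terminals G1) = length (terminals G2)" "length (terminals H1) = length (terminals H2)"
      "length Ps1 = length Ps2"
      and eqs: "mtype M (Suc k) G1 (map lpart Ps1) = mtype M (Suc k) G2 (map lpart Ps2)"
        "mtype M (Suc k) H1 (map rpart Ps1) = mtype M (Suc k) H2 (map rpart Ps2)"
    for G1 G2 H1 H2 Ps1 Ps2 S
  proof -
    obtain A where A: "mtype M k G1 (map lpart Ps1 @ [lpart S]) = mtype M k G2 (map lpart Ps2 @ [A])"
      using mtype_move[OF eqs(1)] .
    obtain B where B: "mtype M k H1 (map rpart Ps1 @ [rpart S]) = mtype M k H2 (map rpart Ps2 @ [B])"
      using mtype_move[OF eqs(2)] .
    have "mtype M k (sum_pregraph G1 H1) (Ps1 @ [S]) =
        mtype M k (sum_pregraph G2 H2) (Ps2 @ [join A B])"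
      by (rule Suc.IH) (simp_all add: that(1-3) A B)
    then show ?thesis ..
  qed
  show ?case
    by (rule mtype_Suc_eqI; rule respond) (simp_all only: Suc.prems)
qed

section \<open>Recognisability\<close>

lift_definition ttype :: "nat \<Rightarrow> nat \<Rightarrow> tgraph \<Rightarrow> nat" is "\<lambda>M k G. mtype M k G []"
  by (rule mtype_iso)

lemma ttype_sum:
  "gtype G = gtype G' \<Longrightarrow> gtype H = gtype H' \<Longrightarrow> ttype M k G = ttype M k G' \<Longrightarrow>
    ttype M k H = ttype M k H' \<Longrightarrow> ttype M k (sum_graph G H) = ttype M k (sum_graph G' H')"
  by transfer (rule mtype_sum; simp)

lemma ttype_redef:
  "gtype G = gtype H \<Longrightarrow> set \<sigma> \<subseteq> {..<gtype G} \<Longrightarrow> ttype M k G = ttype M k H \<Longrightarrow>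
    ttype M k (redef_graph \<sigma> G) = ttype M k (redef_graph \<sigma> H)"
  by transfer (rule mtype_redef; simp add: graph_iso_def)

lemma ttype_fuse:
  "gtype G = gtype H \<Longrightarrow> a < gtype G \<Longrightarrow> b < gtype G \<Longrightarrow> ttype M k G = ttype M k H \<Longrightarrow>
    ttype M k (fuse_graph a b G) = ttype M k (fuse_graph a b H)"
  by transfer (rule mtype_fuse; simp add: graph_iso_def)

lemma finite_ttype: "finite (ttype M k ` {G. gtype G = n})"
proof -
  obtain T where T: "finite T"
    "\<forall>(G :: nat graph) Ps. length (terminals G) = n \<longrightarrow> length Ps = 0 \<longrightarrow> mtype M k G Ps \<in> T"
    using mtype_bounded[of n 0 M k] by blast
  from T(2) have "\<forall>G. gtype G = n \<longrightarrow> ttype M k G \<in> T"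
    by transfer simp
  then have "ttype M k ` {G. gtype G = n} \<subseteq> T" by blast
  then show ?thesis using T(1) by (rule finite_subset)
qed

text \<open>\<open>graph_models\<close> quantifies over assignments. For a sentence those on the two
  sides may be chosen independently, and a graph has a vertex with which to instantiate the ones in
  \<open>G\<close>.\<close>

lemma graph_models_mtype:
  assumes \<phi>: "sentence \<phi>" and wf: "wf_graph G" "wf_graph H"
    and eq: "length (terminals G) = length (terminals H)"
      "mtype (width \<phi>) (Suc (depth \<phi>)) G [] = mtype (width \<phi>) (Suc (depth \<phi>)) H []"
    and G: "graph_models G \<phi>"
  shows "graph_models H \<phi>"
  unfolding graph_models_def
proof (intro allI impI)
  fix i' s'
  obtain v where v: "v \<in> verts G" using wf(1) by (auto simp: wf_graph_def)
  have "sat G (\<lambda>_. v) (\<lambda>_. {}) \<phi>"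
    using G v by (auto simp: graph_models_def inds_def vesets_def)
  moreover have "sat G (\<lambda>_. v) (\<lambda>_. {}) \<phi> \<longleftrightarrow> sat H i' s' \<phi>"
    by (rule mtype_sat[OF wf eq(1) _ lessI order_refl eq(2)])
      (use \<phi> in \<open>simp_all add: codes_def sentence_def\<close>)
  ultimately show "sat H i' s' \<phi>" by simp
qed

lemma models_ttype:
  "sentence \<phi> \<Longrightarrow> gtype G = gtype H \<Longrightarrow>
    ttype (width \<phi>) (Suc (depth \<phi>)) G = ttype (width \<phi>) (Suc (depth \<phi>)) H \<Longrightarrow>
    models G \<phi> \<Longrightarrow> models H \<phi>"
  by transfer (rule graph_models_mtype; simp add: graph_iso_def)

text \<open>The lemmas on the operations compare graphs with equally many terminals; this comes from
  both argument tuples lying in the same carriers.\<close>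

lemma congruence_ttype: "congruence graph_algebra (\<lambda>_. ttype M k)"
  unfolding congruence_def
proof (intro ballI impI)
  fix f xs ys
  let ?w = "inputs (sig graph_algebra) f"
  assume f: "f \<in> syms (sig graph_algebra)" and "xs \<in> args graph_algebra ?w"
    "ys \<in> args graph_algebra ?w" "map2 (\<lambda>_. ttype M k) ?w xs = map2 (\<lambda>_. ttype M k) ?w ys"
  then have "ttype M k (gsym_oper f xs) = ttype M k (gsym_oper f ys)"
    by (cases f)
      (auto simp: graph_algebra_def args_def list_all2_Cons2
        intro: ttype_sum ttype_redef[OF sym] ttype_fuse)
  then show "ttype M k (oper graph_algebra f xs) = ttype M k (oper graph_algebra f ys)"
    by (simp add: graph_algebra_def)
qed

theorem theorem7p1p2:
  fixes A :: "(nat, (nat, gsym, tgraph) inherited_sym, tgraph) algebra"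
    and \<phi> :: mso and n :: nat
  assumes "inherited A graph_algebra"
    and "sentence \<phi>"
  shows "recognisable A n {G \<in> carr A n. models G \<phi>}"
proof -
  let ?F = "flattening (alg_closure graph_algebra)"
  \<comment> \<open>The words in \<open>Incid\<close> may be as long as the longest
    \<open>Conn\<close> of the sentence, and the rank is one above its depth, as
    \<open>mtype_sat\<close> requires.\<close>
  let ?c = "\<lambda>_ :: nat. ttype (width \<phi>) (Suc (depth \<phi>))"
  have sub: "subalgebra A ?F" using assms(1) by (simp add: inherited_def)
  have F: "is_algebra (alg_closure graph_algebra)" "is_algebra ?F"
    by (simp_all add: is_algebra_alg_closure is_algebra_flattening is_algebra_graph_algebra)
  have "sorts (sig ?F) = UNIV" "carr ?F u = {G. gtype G = u}" for u
    by (simp_all add: flattening_def alg_closure_def graph_algebra_def)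
  then have sorts: "sorts (sig A) = UNIV" and carr: "carr A u \<subseteq> {G. gtype G = u}" for u
    using sub unfolding subalgebra_def by auto
  show ?thesis
  proof (rule recognisable_congruence)
    show "is_algebra A" using sub by (simp add: subalgebra_def)
    show "congruence A ?c"
      by (intro congruence_subalgebra[OF sub F(2)] congruence_flattening[OF F(1)]
          congruence_alg_closure congruence_ttype)
    show "finite (?c u ` carr A u)" for u
      using finite_subset[OF image_mono[OF carr] finite_ttype] .
    show "n \<in> sorts (sig A)" by (simp add: sorts)
    show "y \<in> {G \<in> carr A n. models G \<phi>}"
      if "x \<in> {G \<in> carr A n. models G \<phi>}" "y \<in> carr A n" "?c n x = ?c n y" for x y
      using models_ttype[OF assms(2), of x y] that carr by auto
  qed blast
qed

end
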